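(* Let $T$ be the free category monad on the category $\mathrm{Graph}$ of graphs, and let $i_0:\Delta_0\to \mathrm{Graph}$ be the functor sending $[n]$ to the linear (filiform) graph $0\to 1\to\cdots\to n$. Then $T$ is a monad with arity functor $i_0$; that is, $i_0$ is fully faithful and dense, the identity natural transformation $T\circ i_0\Rightarrow T\circ i_0$ exhibits $T$ as a left Kan extension of $T\circ i_0$ along $i_0$, and this left Kan extension is preserved by the nerve functor $\mathrm{Graph}(i_0,1):\mathrm{Graph}\to\widehat{\Delta_0}$.
   Context: For a small category $\Theta$, $\widehat{\Theta}$ denotes the category of presheaves $\Theta^{op}\to \mathrm{Set}$. A graph is a presheaf on the category with two objects $0,1$ and exactly two non-identity arrows $s,t:0\to 1$ (i.e. a directed multigraph: a set of vertices and a set of edges with source and target maps); morphisms of graphs are natural transformations. $\mathrm{Graph}$ is the category of graphs. $\Delta_0$ is the category whose objects are the finite ordinals $[n]=\{0,\ldots,n\}$, $n\ge 0$, and whose morphisms $[m]\to[n]$ are the functions $f$ with $f(p+1)=f(p)+1$ for all $0\le p\le m-1$. The functor $i_0$ sends $[n]$ to the graph with vertices $0,\ldots,n$ and exactly one edge $p-1\to p$ for each $1\le p\le n$, and acts on morphisms in the evident way. The free category monad $T$ sends a graph $G$ to the underlying graph of the free category on $G$: its vertices are those of $G$, and its edges are the finite (possibly empty) paths of composable edges of $G$. The unit sends an edge to the corresponding path of length $1$, and the multiplication concatenates paths of paths. A functor $i:\mathcal{C}\to\mathcal{D}$ with $\mathcal{C}$ small and $\mathcal{D}$ locally small is dense if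 the nerve functor $\mathcal{D}(i,1):\mathcal{D}\to\widehat{\mathcal{C}}$, $D\mapsto \mathcal{D}(i(-),D)$, is fully faithful. A monad with arities consists of a monad $T$ on a category $\mathcal{A}$ and a fully faithful and dense functor $i_0:\Theta_0\to\mathcal{A}$ with $\Theta_0$ small, such that (1) the identity natural transformation exhibits $T$ as a left Kan extension of $T\circ i_0$ along $i_0$, and (2) this Kan extension is preserved by $\mathcal{A}(i_0,1):\mathcal{A}\to\widehat{\Theta_0}$, i.e. the identity exhibits $\mathcal{A}(i_0,1)\circ T$ as a left Kan extension of $\mathcal{A}(i_0,1)\circ T\circ i_0$ along $i_0$. The functor $i_0$ is then called the arity functor. *)

theory Defs
  imports Main "HOL-Library.FuncSet"
begin

section \<open>Universes of small sets\<close>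

text \<open>
  ``Small set'' means: member of a family \<open>S\<close> of subsets of a type \<open>'u\<close>, closed under subsets,
  images and small unions and containing an infinite set.  Closure under power sets is not
  demanded: a Grothendieck universe qualifies, and so does the family of all subsets of any
  infinite type, so that the notion is satisfiable in plain HOL (lemma \<open>universe_UNIV\<close>).
\<close>

definition universe :: "'u set set \<Rightarrow> bool" where
  "universe S \<longleftrightarrow>
     (\<exists>X\<in>S. infinite X) \<and>
     (\<forall>X\<in>S. \<forall>Y. Y \<subseteq> X \<longrightarrow> Y \<in> S) \<and>
     (\<forall>X\<in>S. \<forall>f. f ` X \<in> S) \<and>
     (\<forall>X\<in>S. \<forall>F. (\<forall>x\<in>X. F x \<in> S) \<longrightarrow> (\<Union>x\<in>X. F x) \<in> S)"

definition small_set :: "'u set set \<Rightarrow> 'x set \<Rightarrow> bool" where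
  "small_set S X \<longleftrightarrow> (\<exists>f. inj_on f X \<and> f ` X \<in> S)"

lemma universe_UNIV:
  assumes "infinite (UNIV :: 'u set)"
  shows "universe (UNIV :: 'u set set)"
  using assms unfolding universe_def by blast

lemma universe_infinite_type:
  assumes "universe (S :: 'u set set)"
  shows "infinite (UNIV :: 'u set)"
  using assms unfolding universe_def by (meson infinite_super subset_UNIV)


section \<open>Categories, functors and natural transformations\<close>

text \<open>
  Hom-sets are indexed by their end points and need not be disjoint, so composition and the
  action of a functor on arrows take the objects involved as arguments:
  \<open>Comp C a b c g f\<close> is the composite of \<open>f : a \<rightarrow> b\<close> and \<open>g : b \<rightarrow> c\<close>.
\<close>

record ('o, 'a) cat =
  Obj :: "'o set"
  Hom :: "'o \<Rightarrow> 'o \<Rightarrow> 'a set"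
  Ident :: "'o \<Rightarrow> 'a"
  Comp :: "'o \<Rightarrow> 'o \<Rightarrow> 'o \<Rightarrow> 'a \<Rightarrow> 'a \<Rightarrow> 'a"

definition category :: "('o, 'a) cat \<Rightarrow> bool" where
  "category C \<longleftrightarrow>
     (\<forall>a\<in>Obj C. Ident C a \<in> Hom C a a) \<and>
     (\<forall>a\<in>Obj C. \<forall>b\<in>Obj C. \<forall>c\<in>Obj C. \<forall>f\<in>Hom C a b. \<forall>g\<in>Hom C b c.
        Comp C a b c g f \<in> Hom C a c) \<and>
     (\<forall>a\<in>Obj C. \<forall>b\<in>Obj C. \<forall>f\<in>Hom C a b.
        Comp C a a b f (Ident C a) = f \<and> Comp C a b b (Ident C b) f = f) \<and>
     (\<forall>a\<in>Obj C. \<forall>b\<in>Obj C. \<forall>c\<in>Obj C. \<forall>d\<in>Obj C.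
        \<forall>f\<in>Hom C a b. \<forall>g\<in>Hom C b c. \<forall>h\<in>Hom C c d.
        Comp C a c d h (Comp C a b c g f) = Comp C a b d (Comp C b c d h g) f)"

definition small_category :: "'u set set \<Rightarrow> ('o, 'a) cat \<Rightarrow> bool" where
  "small_category S C \<longleftrightarrow> category C \<and> small_set S (Obj C) \<and>
     (\<forall>a\<in>Obj C. \<forall>b\<in>Obj C. small_set S (Hom C a b))"

definition op_cat :: "('o, 'a) cat \<Rightarrow> ('o, 'a) cat" where
  "op_cat C = \<lparr> Obj = Obj C, Hom = (\<lambda>a b. Hom C b a), Ident = Ident C,
                Comp = (\<lambda>a b c g f. Comp C c b a f g) \<rparr>"

record ('o, 'a, 'p, 'b) ftor =
  FObj :: "'o \<Rightarrow> 'p"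
  FArr :: "'o \<Rightarrow> 'o \<Rightarrow> 'a \<Rightarrow> 'b"

definition is_functor :: "('o, 'a) cat \<Rightarrow> ('p, 'b) cat \<Rightarrow> ('o, 'a, 'p, 'b) ftor \<Rightarrow> bool" where
  "is_functor C D F \<longleftrightarrow> category C \<and> category D \<and>
     (\<forall>a\<in>Obj C. FObj F a \<in> Obj D) \<and>
     (\<forall>a\<in>Obj C. \<forall>b\<in>Obj C. \<forall>f\<in>Hom C a b. FArr F a b f \<in> Hom D (FObj F a) (FObj F b)) \<and>
     (\<forall>a\<in>Obj C. FArr F a a (Ident C a) = Ident D (FObj F a)) \<and>
     (\<forall>a\<in>Obj C. \<forall>b\<in>Obj C. \<forall>c\<in>Obj C. \<forall>f\<in>Hom C a b. \<forall>g\<in>Hom C b c.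
        FArr F a c (Comp C a b c g f) =
        Comp D (FObj F a) (FObj F b) (FObj F c) (FArr F b c g) (FArr F a b f))"

definition fully_faithful :: "('o, 'a) cat \<Rightarrow> ('p, 'b) cat \<Rightarrow> ('o, 'a, 'p, 'b) ftor \<Rightarrow> bool" where
  "fully_faithful C D F \<longleftrightarrow> is_functor C D F \<and>
     (\<forall>a\<in>Obj C. \<forall>b\<in>Obj C. bij_betw (FArr F a b) (Hom C a b) (Hom D (FObj F a) (FObj F b)))"

definition id_functor :: "('o, 'a, 'o, 'a) ftor" where
  "id_functor = \<lparr> FObj = (\<lambda>a. a), FArr = (\<lambda>a b f. f) \<rparr>"

definition comp_functor ::
  "('p, 'b, 'q, 'c) ftor \<Rightarrow> ('o, 'a, 'p, 'b) ftor \<Rightarrow> ('o, 'a, 'q, 'c) ftor" (infixr "\<circ>\<^sub>F" 55) where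
  "G \<circ>\<^sub>F F = \<lparr> FObj = (\<lambda>a. FObj G (FObj F a)),
              FArr = (\<lambda>a b f. FArr G (FObj F a) (FObj F b) (FArr F a b f)) \<rparr>"

text \<open>Components are extensional, so that equality of transformations is HOL equality.\<close>

definition nat_trans ::
  "('o, 'a) cat \<Rightarrow> ('p, 'b) cat \<Rightarrow> ('o, 'a, 'p, 'b) ftor \<Rightarrow> ('o, 'a, 'p, 'b) ftor \<Rightarrow>
   ('o \<Rightarrow> 'b) \<Rightarrow> bool" where
  "nat_trans C D F G \<tau> \<longleftrightarrow> is_functor C D F \<and> is_functor C D G \<and>
     \<tau> \<in> (\<Pi>\<^sub>E a\<in>Obj C. Hom D (FObj F a) (FObj G a)) \<and>
     (\<forall>a\<in>Obj C. \<forall>b\<in>Obj C. \<forall>f\<in>Hom C a b.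
        Comp D (FObj F a) (FObj F b) (FObj G b) (\<tau> b) (FArr F a b f) =
        Comp D (FObj F a) (FObj G a) (FObj G b) (FArr G a b f) (\<tau> a))"

definition id_trans ::
  "('o, 'a) cat \<Rightarrow> ('p, 'b) cat \<Rightarrow> ('o, 'a, 'p, 'b) ftor \<Rightarrow> ('o \<Rightarrow> 'b)" where
  "id_trans C D F = (\<lambda>a\<in>Obj C. Ident D (FObj F a))"

definition ext_functor :: "('o, 'a) cat \<Rightarrow> ('o, 'a, 'p, 'b) ftor \<Rightarrow> bool" where
  "ext_functor C F \<longleftrightarrow> FObj F \<in> extensional (Obj C) \<and>
     (\<forall>a b f. \<not> (a \<in> Obj C \<and> b \<in> Obj C \<and> f \<in> Hom C a b) \<longrightarrow> FArr F a b f = undefined)"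

definition restrict_functor ::
  "('o, 'a) cat \<Rightarrow> ('o, 'a, 'p, 'b) ftor \<Rightarrow> ('o, 'a, 'p, 'b) ftor" where
  "restrict_functor C F = \<lparr> FObj = (\<lambda>a\<in>Obj C. FObj F a),
     FArr = (\<lambda>a b f. if a \<in> Obj C \<and> b \<in> Obj C \<and> f \<in> Hom C a b
                      then FArr F a b f else undefined) \<rparr>"

definition functor_cat ::
  "('o, 'a) cat \<Rightarrow> ('p, 'b) cat \<Rightarrow> (('o, 'a, 'p, 'b) ftor, 'o \<Rightarrow> 'b) cat" where
  "functor_cat C D =
     \<lparr> Obj = {F. is_functor C D F \<and> ext_functor C F},
       Hom = (\<lambda>F G. {\<tau>. nat_trans C D F G \<tau>}),
       Ident = id_trans C D,
       Comp = (\<lambda>F G H \<tau> \<sigma>. \<lambda>a\<in>Obj C. Comp D (FObj F a) (FObj G a) (FObj H a) (\<tau> a) (\<sigma> a)) \<rparr>"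


section \<open>Presheaves, nerves and density\<close>

definition set_cat :: "'u set set \<Rightarrow> ('u set, 'u \<Rightarrow> 'u) cat" where
  "set_cat S = \<lparr> Obj = S, Hom = (\<lambda>A B. A \<rightarrow>\<^sub>E B), Ident = (\<lambda>A. \<lambda>x\<in>A. x),
                 Comp = (\<lambda>A B C g f. compose A g f) \<rparr>"

type_synonym ('o, 'a, 'u) presheaf = "('o, 'a, 'u set, 'u \<Rightarrow> 'u) ftor"

definition presheaf_cat ::
  "'u set set \<Rightarrow> ('o, 'a) cat \<Rightarrow> (('o, 'a, 'u) presheaf, 'o \<Rightarrow> 'u \<Rightarrow> 'u) cat" where
  "presheaf_cat S C = functor_cat (op_cat C) (set_cat S)"

text \<open>
  A hom-set is a set of arrows, not a subset of \<open>'u\<close>; as an object of \<open>set_cat S\<close> it is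
  represented by its image under a chosen injection with small image, which exists whenever
  the hom-set is small.
\<close>

definition hom_code :: "'u set set \<Rightarrow> ('p, 'b) cat \<Rightarrow> 'p \<Rightarrow> 'p \<Rightarrow> 'b \<Rightarrow> 'u" where
  "hom_code S D x y = (SOME f. inj_on f (Hom D x y) \<and> f ` Hom D x y \<in> S)"

definition hom_obj :: "'u set set \<Rightarrow> ('p, 'b) cat \<Rightarrow> 'p \<Rightarrow> 'p \<Rightarrow> 'u set" where
  "hom_obj S D x y = hom_code S D x y ` Hom D x y"

definition hom_decode :: "'u set set \<Rightarrow> ('p, 'b) cat \<Rightarrow> 'p \<Rightarrow> 'p \<Rightarrow> 'u \<Rightarrow> 'b" where
  "hom_decode S D x y = inv_into (Hom D x y) (hom_code S D x y)"

lemma hom_code: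
  assumes "small_set S (Hom D x y)"
  shows "inj_on (hom_code S D x y) (Hom D x y)" "hom_obj S D x y \<in> S"
proof -
  have "inj_on (hom_code S D x y) (Hom D x y) \<and> hom_code S D x y ` Hom D x y \<in> S"
    unfolding hom_code_def using assms unfolding small_set_def by (rule someI_ex)
  then show "inj_on (hom_code S D x y) (Hom D x y)" "hom_obj S D x y \<in> S"
    by (auto simp: hom_obj_def)
qed

definition nerve_obj ::
  "'u set set \<Rightarrow> ('o, 'a) cat \<Rightarrow> ('p, 'b) cat \<Rightarrow> ('o, 'a, 'p, 'b) ftor \<Rightarrow> 'p \<Rightarrow>
   ('o, 'a, 'u) presheaf" where
  "nerve_obj S C D i d = restrict_functor (op_cat C)
     \<lparr> FObj = (\<lambda>c. hom_obj S D (FObj i c) d),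
       FArr = (\<lambda>c c' f. \<lambda>x\<in>hom_obj S D (FObj i c) d.
         hom_code S D (FObj i c') d
           (Comp D (FObj i c') (FObj i c) d (hom_decode S D (FObj i c) d x) (FArr i c' c f))) \<rparr>"

definition nerve ::
  "'u set set \<Rightarrow> ('o, 'a) cat \<Rightarrow> ('p, 'b) cat \<Rightarrow> ('o, 'a, 'p, 'b) ftor \<Rightarrow>
   ('p, 'b, ('o, 'a, 'u) presheaf, 'o \<Rightarrow> 'u \<Rightarrow> 'u) ftor" where
  "nerve S C D i =
     \<lparr> FObj = nerve_obj S C D i,
       FArr = (\<lambda>d d' g. \<lambda>c\<in>Obj C. \<lambda>x\<in>hom_obj S D (FObj i c) d.
         hom_code S D (FObj i c) d'
           (Comp D (FObj i c) d d' g (hom_decode S D (FObj i c) d x))) \<rparr>"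

text \<open>
  Only the hom-sets out of objects in the image of \<open>i\<close> are required to be small; this is what the
  nerve needs, and without closure of \<open>S\<close> under power sets it is all that can be expected.
\<close>

definition dense_functor ::
  "'u set set \<Rightarrow> ('o, 'a) cat \<Rightarrow> ('p, 'b) cat \<Rightarrow> ('o, 'a, 'p, 'b) ftor \<Rightarrow> bool" where
  "dense_functor S C D i \<longleftrightarrow>
     small_category S C \<and> is_functor C D i \<and>
     (\<forall>c\<in>Obj C. \<forall>d\<in>Obj D. small_set S (Hom D (FObj i c) d)) \<and>
     fully_faithful D (presheaf_cat S C) (nerve S C D i)"


section \<open>Kan extensions, monads and arities\<close>

text \<open>\<open>\<eta> : F \<Rightarrow> L K\<close> exhibits \<open>L : B \<rightarrow> E\<close> as a left Kan extension of \<open>F : A \<rightarrow> E\<close> along \<open>K : A \<rightarrow> B\<close>.\<close>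

definition is_left_kan_extension ::
  "('o, 'a) cat \<Rightarrow> ('p, 'b) cat \<Rightarrow> ('q, 'c) cat \<Rightarrow>
   ('o, 'a, 'p, 'b) ftor \<Rightarrow> ('o, 'a, 'q, 'c) ftor \<Rightarrow> ('p, 'b, 'q, 'c) ftor \<Rightarrow>
   ('o \<Rightarrow> 'c) \<Rightarrow> bool" where
  "is_left_kan_extension A B E K F L \<eta> \<longleftrightarrow>
     is_functor A B K \<and> is_functor A E F \<and> is_functor B E L \<and>
     nat_trans A E F (L \<circ>\<^sub>F K) \<eta> \<and>
     (\<forall>H \<alpha>. is_functor B E H \<and> nat_trans A E F (H \<circ>\<^sub>F K) \<alpha> \<longrightarrow>
        (\<exists>!\<beta>. nat_trans B E L H \<beta> \<and>
           (\<forall>a\<in>Obj A. Comp E (FObj F a) (FObj L (FObj K a)) (FObj H (FObj K a))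
                         (\<beta> (FObj K a)) (\<eta> a) = \<alpha> a)))"

definition is_monad ::
  "('o, 'a) cat \<Rightarrow> ('o, 'a, 'o, 'a) ftor \<Rightarrow> ('o \<Rightarrow> 'a) \<Rightarrow> ('o \<Rightarrow> 'a) \<Rightarrow> bool" where
  "is_monad A T \<eta> \<mu> \<longleftrightarrow>
     is_functor A A T \<and>
     nat_trans A A id_functor T \<eta> \<and>
     nat_trans A A (T \<circ>\<^sub>F T) T \<mu> \<and>
     (\<forall>a\<in>Obj A. let Ta = FObj T a; TTa = FObj T Ta; TTTa = FObj T TTa in
        Comp A TTTa TTa Ta (\<mu> a) (FArr T TTa Ta (\<mu> a)) = Comp A TTTa TTa Ta (\<mu> a) (\<mu> Ta) \<and>
        Comp A Ta TTa Ta (\<mu> a) (\<eta> Ta) = Ident A Ta \<and>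
        Comp A Ta TTa Ta (\<mu> a) (FArr T a Ta (\<eta> a)) = Ident A Ta)"

definition monad_with_arities ::
  "'u set set \<Rightarrow> ('p, 'b) cat \<Rightarrow> ('p, 'b, 'p, 'b) ftor \<Rightarrow> ('p \<Rightarrow> 'b) \<Rightarrow> ('p \<Rightarrow> 'b) \<Rightarrow>
   ('o, 'a) cat \<Rightarrow> ('o, 'a, 'p, 'b) ftor \<Rightarrow> bool" where
  "monad_with_arities S A T \<eta> \<mu> \<Theta> i \<longleftrightarrow>
     is_monad A T \<eta> \<mu> \<and>
     small_category S \<Theta> \<and>
     fully_faithful \<Theta> A i \<and>
     dense_functor S \<Theta> A i \<and>
     is_left_kan_extension \<Theta> A A i (T \<circ>\<^sub>F i) T (id_trans \<Theta> A (T \<circ>\<^sub>F i)) \<and>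
     (let N = nerve S \<Theta> A i; P = presheaf_cat S \<Theta> in
        is_left_kan_extension \<Theta> A P i (N \<circ>\<^sub>F T \<circ>\<^sub>F i) (N \<circ>\<^sub>F T)
          (id_trans \<Theta> P (N \<circ>\<^sub>F T \<circ>\<^sub>F i)))"


section \<open>Graphs\<close>

record 'u mgraph =
  Verts :: "'u set"
  Edges :: "'u set"
  Src :: "'u \<Rightarrow> 'u"
  Tgt :: "'u \<Rightarrow> 'u"

text \<open>
  A presheaf on the category with two objects and two parallel non-identity arrows, written out;
  a morphism is its pair of components (on vertices, on edges).
\<close>

definition graph_cat :: "'u set set \<Rightarrow> ('u mgraph, ('u \<Rightarrow> 'u) \<times> ('u \<Rightarrow> 'u)) cat" where
  "graph_cat S =
     \<lparr> Obj = {G. Verts G \<in> S \<and> Edges G \<in> S \<and>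
                 Src G \<in> Edges G \<rightarrow>\<^sub>E Verts G \<and> Tgt G \<in> Edges G \<rightarrow>\<^sub>E Verts G},
       Hom = (\<lambda>G H. {(f, g). f \<in> Verts G \<rightarrow>\<^sub>E Verts H \<and> g \<in> Edges G \<rightarrow>\<^sub>E Edges H \<and>
                 (\<forall>e\<in>Edges G. Src H (g e) = f (Src G e) \<and> Tgt H (g e) = f (Tgt G e))}),
       Ident = (\<lambda>G. (\<lambda>v\<in>Verts G. v, \<lambda>e\<in>Edges G. e)),
       Comp = (\<lambda>G H K p q. (compose (Verts G) (fst p) (fst q),
                             compose (Edges G) (snd p) (snd q))) \<rparr>"


section \<open>The free category monad\<close>

text \<open>
  A path is given by its starting vertex and its list of edges; the starting vertex separates
  the empty paths at different vertices.
\<close>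

fun is_path :: "'u mgraph \<Rightarrow> 'u \<Rightarrow> 'u list \<Rightarrow> bool" where
  "is_path G v [] \<longleftrightarrow> v \<in> Verts G"
| "is_path G v (e # es) \<longleftrightarrow> e \<in> Edges G \<and> Src G e = v \<and> is_path G (Tgt G e) es"

fun path_end :: "'u mgraph \<Rightarrow> 'u \<Rightarrow> 'u list \<Rightarrow> 'u" where
  "path_end G v [] = v"
| "path_end G v (e # es) = path_end G (Tgt G e) es"

text \<open>
  For paths to be edges of a graph over \<open>'u\<close> again they are coded by elements of \<open>'u\<close>, using an
  arbitrary injection.
\<close>

definition path_code :: "'u \<times> 'u list \<Rightarrow> 'u" where
  "path_code = (SOME f. inj f)"

definition path_decode :: "'u \<Rightarrow> 'u \<times> 'u list" where
  "path_decode = inv path_code"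

lemma inj_path_code:
  assumes "infinite (UNIV :: 'u set)"
  shows "inj (path_code :: 'u \<times> 'u list \<Rightarrow> 'u)"
proof -
  obtain p :: "'u \<times> 'u \<Rightarrow> 'u" where "bij_betw p (UNIV \<times> UNIV) UNIV"
    using card_of_Times_same_infinite[OF assms] card_of_ordIso by blast
  then have p: "inj p" by (simp add: bij_betw_def)
  obtain c :: "nat \<Rightarrow> 'u" where c: "inj c"
    using infinite_countable_subset[OF assms] by blast
  define l where "l = (\<lambda>xs :: 'u list. foldr (\<lambda>x y. p (x, y)) xs (c 0))"
  have l: "l xs = l ys \<Longrightarrow> length xs = length ys \<Longrightarrow> xs = ys" for xs ys
  proof (induction xs arbitrary: ys)
    case Nil
    then show ?case by simp
  next
    case (Cons x xs)
    then obtain y ys' where "ys = y # ys'" by (metis length_Suc_conv)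
    with Cons show ?case by (auto simp: l_def dest: injD[OF p])
  qed
  have "inj (\<lambda>(v, xs). p (v, p (c (length xs), l xs)))"
    by (auto intro!: injI dest!: injD[OF p] injD[OF c] dest: l)
  then show ?thesis unfolding path_code_def by (rule someI[of inj])
qed

definition free_graph :: "'u mgraph \<Rightarrow> 'u mgraph" where
  "free_graph G = (let P = path_code ` {(v, es). is_path G v es} in
     \<lparr> Verts = Verts G,
       Edges = P,
       Src = (\<lambda>p\<in>P. case path_decode p of (v, es) \<Rightarrow> v),
       Tgt = (\<lambda>p\<in>P. case path_decode p of (v, es) \<Rightarrow> path_end G v es) \<rparr>)"

definition free_functor ::
  "('u mgraph, ('u \<Rightarrow> 'u) \<times> ('u \<Rightarrow> 'u), 'u mgraph, ('u \<Rightarrow> 'u) \<times> ('u \<Rightarrow> 'u)) ftor" where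
  "free_functor =
     \<lparr> FObj = free_graph,
       FArr = (\<lambda>G H (f, g). (f, \<lambda>p\<in>Edges (free_graph G).
                  case path_decode p of (v, es) \<Rightarrow> path_code (f v, map g es))) \<rparr>"

definition free_unit :: "'u set set \<Rightarrow> 'u mgraph \<Rightarrow> ('u \<Rightarrow> 'u) \<times> ('u \<Rightarrow> 'u)" where
  "free_unit S = (\<lambda>G\<in>Obj (graph_cat S).
     (\<lambda>v\<in>Verts G. v, \<lambda>e\<in>Edges G. path_code (Src G e, [e])))"

definition free_mult :: "'u set set \<Rightarrow> 'u mgraph \<Rightarrow> ('u \<Rightarrow> 'u) \<times> ('u \<Rightarrow> 'u)" where
  "free_mult S = (\<lambda>G\<in>Obj (graph_cat S).
     (\<lambda>v\<in>Verts G. v,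
      \<lambda>p\<in>Edges (free_graph (free_graph G)).
        case path_decode p of (v, ps) \<Rightarrow>
          path_code (v, concat (map (\<lambda>q. snd (path_decode q)) ps))))"


section \<open>Linear graphs\<close>

text \<open>The object \<open>n\<close> stands for the ordinal \<open>{0..n}\<close>.\<close>

definition Delta0 :: "(nat, nat \<Rightarrow> nat) cat" where
  "Delta0 =
     \<lparr> Obj = UNIV,
       Hom = (\<lambda>m n. {f \<in> {0..m} \<rightarrow>\<^sub>E {0..n}. \<forall>p<m. f (p + 1) = f p + 1}),
       Ident = (\<lambda>m. \<lambda>p\<in>{0..m}. p),
       Comp = (\<lambda>l m n g f. compose {0..l} g f) \<rparr>"

definition nat_code :: "nat \<Rightarrow> 'u" where
  "nat_code = (SOME f. inj f)"

lemma inj_nat_code: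
  assumes "infinite (UNIV :: 'u set)"
  shows "inj (nat_code :: nat \<Rightarrow> 'u)"
proof -
  have "\<exists>f :: nat \<Rightarrow> 'u. inj f"
    using infinite_countable_subset[OF assms] by blast
  then show ?thesis unfolding nat_code_def by (rule someI_ex[of inj])
qed

text \<open>
  Vertex \<open>p\<close> is coded by \<open>nat_code p\<close>, and so is the edge from \<open>p - 1\<close> to \<open>p\<close>, for \<open>1 \<le> p \<le> n\<close>
  (vertices and edges of a graph need not be disjoint).
\<close>

definition linear_graph :: "nat \<Rightarrow> 'u mgraph" where
  "linear_graph n =
     \<lparr> Verts = nat_code ` {0..n},
       Edges = nat_code ` {1..n},
       Src = (\<lambda>e\<in>nat_code ` {1..n}. nat_code (inv nat_code e - 1)),
       Tgt = (\<lambda>e\<in>nat_code ` {1..n}. e) \<rparr>"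

definition linear_functor ::
  "(nat, nat \<Rightarrow> nat, 'u mgraph, ('u \<Rightarrow> 'u) \<times> ('u \<Rightarrow> 'u)) ftor" where
  "linear_functor =
     \<lparr> FObj = linear_graph,
       FArr = (\<lambda>m n f. (\<lambda>v\<in>nat_code ` {0..m}. nat_code (f (inv nat_code v)),
                         \<lambda>e\<in>nat_code ` {1..m}. nat_code (f (inv nat_code e)))) \<rparr>"

end

theory Submission
  imports Defs
begin

text \<open>
  An arrow \<open>x : [n] \<rightarrow> T G\<close> is a composable sequence of \<open>n\<close> paths in \<open>G\<close>. Concatenating them gives a
  path \<open>u : [k] \<rightarrow> G\<close>, and \<open>x = T u \<circ> y\<close> where \<open>y : [n] \<rightarrow> T [k]\<close> depends only on the lengths of the
  paths. This factorization is initial among all factorizations of \<open>x\<close> through some \<open>T u'\<close> with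
  \<open>u' : [k'] \<rightarrow> G\<close>, since post-composition with \<open>T u'\<close> preserves lengths and concatenation. Hence a
  transformation \<open>\<alpha> : N T i \<Rightarrow> H i\<close> extends uniquely to \<open>N T\<close> by \<open>x \<mapsto> H(u) (\<alpha> y)\<close>, which makes \<open>N T\<close> a
  left Kan extension. The nerve \<open>N\<close> is fully faithful because a morphism out of a graph is determined
  by its effect on arrows from \<open>[0]\<close> and \<open>[1]\<close>; a fully faithful functor reflects Kan extensions,
  so \<open>T\<close> is one as well.
\<close>

section \<open>Categories and Kan extensions\<close>

text \<open>The left Kan extension identifies pairs \<open>(u, y)\<close> that name the same element
  \<open>x\<close>, in general along zigzags. An initial pair cuts every zigzag down to one arrow:
  each pair is linked to it directly, so a single use of naturality of \<alpha> shows that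
  \<open>H(u)(\<alpha> y)\<close> does not depend on the pair. Initial pairs exist because
  \<open>T\<close> is familial: an arrow \<open>[n] \<rightarrow> T G\<close> amounts to a list of
  \<open>n\<close> block lengths, zero allowed, and a path in \<open>G\<close> whose length
  \<open>k\<close> is their sum. The lengths alone give \<open>y\<close>. The comparison with
  another pair has to be an arrow of \<open>Delta0\<close>; it is one because a path in a linear
  graph is a segment, that is, because \<open>i\<close> is full. Two features of the setting shape
  the bookkeeping. Presheaf values and edge sets are subsets of \<open>'u\<close>, so elements of a
  nerve are codes of arrows and edges of \<open>T G\<close> are codes of paths. And \<open>S\<close>
  may lack power sets, so smallness of hom-sets is derived by counting paths and not from function
  spaces.\<close>

lemma op_cat_simps [simp]:
  "Obj (op_cat C) = Obj C" "Hom (op_cat C) a b = Hom C b a" "Ident (op_cat C) = Ident C"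
  "Comp (op_cat C) a b c g f = Comp C c b a f g"
  by (simp_all add: op_cat_def)

lemma set_cat_simps [simp]:
  "Obj (set_cat S) = S" "Hom (set_cat S) A B = (A \<rightarrow>\<^sub>E B)" "Ident (set_cat S) A = (\<lambda>x\<in>A. x)"
  "Comp (set_cat S) A B C g f = compose A g f"
  by (simp_all add: set_cat_def)

lemma comp_functor_simps [simp]:
  "FObj (G \<circ>\<^sub>F F) a = FObj G (FObj F a)"
  "FArr (G \<circ>\<^sub>F F) a b f = FArr G (FObj F a) (FObj F b) (FArr F a b f)"
  by (simp_all add: comp_functor_def)

text \<open>The infix associates to the right, whereas a Kan extension of the composite
  \<open>N \<circ>\<^sub>F T\<close> along \<open>K\<close> brings up the bracket on the left.
  Functors are records of functions, so the two agree as HOL terms and not merely up to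
  isomorphism.\<close>

lemma comp_functor_assoc: "(H \<circ>\<^sub>F G) \<circ>\<^sub>F F = H \<circ>\<^sub>F (G \<circ>\<^sub>F F)"
  by (simp add: comp_functor_def)

lemma category_Ident: "category C \<Longrightarrow> a \<in> Obj C \<Longrightarrow> Ident C a \<in> Hom C a a"
  by (simp add: category_def)

lemma category_Comp:
  "category C \<Longrightarrow> a \<in> Obj C \<Longrightarrow> b \<in> Obj C \<Longrightarrow> c \<in> Obj C \<Longrightarrow> f \<in> Hom C a b \<Longrightarrow> g \<in> Hom C b c
   \<Longrightarrow> Comp C a b c g f \<in> Hom C a c"
  by (simp add: category_def)

lemma category_Comp_Ident:
  "category C \<Longrightarrow> a \<in> Obj C \<Longrightarrow> b \<in> Obj C \<Longrightarrow> f \<in> Hom C a b \<Longrightarrow> Comp C a a b f (Ident C a) = f"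
  by (simp add: category_def)

lemma category_Ident_Comp:
  "category C \<Longrightarrow> a \<in> Obj C \<Longrightarrow> b \<in> Obj C \<Longrightarrow> f \<in> Hom C a b \<Longrightarrow> Comp C a b b (Ident C b) f = f"
  by (simp add: category_def)

lemma category_assoc:
  "category C \<Longrightarrow> a \<in> Obj C \<Longrightarrow> b \<in> Obj C \<Longrightarrow> c \<in> Obj C \<Longrightarrow> d \<in> Obj C \<Longrightarrow>
   f \<in> Hom C a b \<Longrightarrow> g \<in> Hom C b c \<Longrightarrow> h \<in> Hom C c d \<Longrightarrow>
   Comp C a c d h (Comp C a b c g f) = Comp C a b d (Comp C b c d h g) f"
  unfolding category_def by blast

lemma functor_category: "is_functor C D F \<Longrightarrow> category C" "is_functor C D F \<Longrightarrow> category D"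
  by (simp_all add: is_functor_def)

lemma functor_Obj: "is_functor C D F \<Longrightarrow> a \<in> Obj C \<Longrightarrow> FObj F a \<in> Obj D"
  by (simp add: is_functor_def)

lemma functor_Arr:
  "is_functor C D F \<Longrightarrow> a \<in> Obj C \<Longrightarrow> b \<in> Obj C \<Longrightarrow> f \<in> Hom C a b
   \<Longrightarrow> FArr F a b f \<in> Hom D (FObj F a) (FObj F b)"
  by (simp add: is_functor_def)

lemma functor_Ident:
  "is_functor C D F \<Longrightarrow> a \<in> Obj C \<Longrightarrow> FArr F a a (Ident C a) = Ident D (FObj F a)"
  by (simp add: is_functor_def)

lemma functor_Comp:
  "is_functor C D F \<Longrightarrow> a \<in> Obj C \<Longrightarrow> b \<in> Obj C \<Longrightarrow> c \<in> Obj C \<Longrightarrow> f \<in> Hom C a b \<Longrightarrow> g \<in> Hom C b c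
   \<Longrightarrow> FArr F a c (Comp C a b c g f) =
     Comp D (FObj F a) (FObj F b) (FObj F c) (FArr F b c g) (FArr F a b f)"
  by (simp add: is_functor_def)

lemma category_op_cat: "category C \<Longrightarrow> category (op_cat C)"
  unfolding category_def by auto

lemma category_set_cat: "category (set_cat S)"
  unfolding category_def
proof (intro conjI ballI)
  fix a b c f g assume "f \<in> Hom (set_cat S) a b" "g \<in> Hom (set_cat S) b c"
  then show "Comp (set_cat S) a b c g f \<in> Hom (set_cat S) a c"
    by (auto simp: PiE_iff compose_def)
next
  fix a b f assume "f \<in> Hom (set_cat S) a b"
  then show "Comp (set_cat S) a a b f (Ident (set_cat S) a) = f"
    "Comp (set_cat S) a b b (Ident (set_cat S) b) f = f"
    by (auto simp: PiE_iff compose_def fun_eq_iff extensional_def)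
next
  fix a b c d f g h assume "f \<in> Hom (set_cat S) a b"
  then show "Comp (set_cat S) a c d h (Comp (set_cat S) a b c g f) =
      Comp (set_cat S) a b d (Comp (set_cat S) b c d h g) f"
    by (auto simp: PiE_iff compose_def fun_eq_iff)
qed auto

lemma id_functor_simps [simp]: "FObj id_functor a = a" "FArr id_functor a b f = f"
  by (simp_all add: id_functor_def)

lemma id_functor_functor: "category C \<Longrightarrow> is_functor C C id_functor"
  by (simp add: is_functor_def)

lemma functor_comp_functor:
  assumes "is_functor B E G" "is_functor A B F"
  shows "is_functor A E (G \<circ>\<^sub>F F)"
  using assms unfolding is_functor_def by simp

lemma nat_trans_in:
  "nat_trans C D F G \<tau> \<Longrightarrow> a \<in> Obj C \<Longrightarrow> \<tau> a \<in> Hom D (FObj F a) (FObj G a)"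
  by (auto simp: nat_trans_def)

lemma nat_trans_natural:
  "nat_trans C D F G \<tau> \<Longrightarrow> a \<in> Obj C \<Longrightarrow> b \<in> Obj C \<Longrightarrow> f \<in> Hom C a b \<Longrightarrow>
   Comp D (FObj F a) (FObj F b) (FObj G b) (\<tau> b) (FArr F a b f) =
   Comp D (FObj F a) (FObj G a) (FObj G b) (FArr G a b f) (\<tau> a)"
  by (simp add: nat_trans_def)

lemma nat_trans_functor:
  "nat_trans C D F G \<tau> \<Longrightarrow> is_functor C D F" "nat_trans C D F G \<tau> \<Longrightarrow> is_functor C D G"
  by (simp_all add: nat_trans_def)

lemma nat_trans_extensional: "nat_trans C D F G \<tau> \<Longrightarrow> \<tau> \<in> extensional (Obj C)"
  by (simp add: nat_trans_def PiE_def)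

lemma nat_trans_id_trans:
  assumes F: "is_functor C D F"
  shows "nat_trans C D F F (id_trans C D F)"
  unfolding nat_trans_def id_trans_def
proof (intro conjI ballI F)
  show "(\<lambda>a\<in>Obj C. Ident D (FObj F a)) \<in> (\<Pi>\<^sub>E a\<in>Obj C. Hom D (FObj F a) (FObj F a))"
    using F by (auto intro!: category_Ident functor_Obj functor_category(2))
next
  fix a b f assume a: "a \<in> Obj C" "b \<in> Obj C" "f \<in> Hom C a b"
  note FF = functor_category(2)[OF F] functor_Obj[OF F a(1)] functor_Obj[OF F a(2)]
    functor_Arr[OF F a]
  show "Comp D (FObj F a) (FObj F b) (FObj F b) ((\<lambda>a\<in>Obj C. Ident D (FObj F a)) b) (FArr F a b f) =
    Comp D (FObj F a) (FObj F a) (FObj F b) (FArr F a b f) ((\<lambda>a\<in>Obj C. Ident D (FObj F a)) a)"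
    using a category_Comp_Ident[OF FF] category_Ident_Comp[OF FF] by simp
qed

lemma functor_cat_simps [simp]:
  "Obj (functor_cat C D) = {F. is_functor C D F \<and> ext_functor C F}"
  "Hom (functor_cat C D) F G = {\<tau>. nat_trans C D F G \<tau>}"
  "Ident (functor_cat C D) = id_trans C D"
  "Comp (functor_cat C D) F G H \<tau> \<sigma> =
    (\<lambda>a\<in>Obj C. Comp D (FObj F a) (FObj G a) (FObj H a) (\<tau> a) (\<sigma> a))"
  by (simp_all add: functor_cat_def)

lemma nat_trans_vcomp:
  assumes \<sigma>: "nat_trans C D F G \<sigma>" and \<tau>: "nat_trans C D G H \<tau>"
  shows "nat_trans C D F H (\<lambda>a\<in>Obj C. Comp D (FObj F a) (FObj G a) (FObj H a) (\<tau> a) (\<sigma> a))"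
  unfolding nat_trans_def
proof (intro conjI ballI)
  note F = nat_trans_functor(1)[OF \<sigma>] and G = nat_trans_functor(2)[OF \<sigma>]
    and H = nat_trans_functor(2)[OF \<tau>]
  note D = functor_category(2)[OF F]
  show "is_functor C D F" "is_functor C D H" by fact+
  show "(\<lambda>a\<in>Obj C. Comp D (FObj F a) (FObj G a) (FObj H a) (\<tau> a) (\<sigma> a))
      \<in> (\<Pi>\<^sub>E a\<in>Obj C. Hom D (FObj F a) (FObj H a))"
    by (auto intro!: category_Comp[OF D] functor_Obj[OF F] functor_Obj[OF G] functor_Obj[OF H]
        nat_trans_in[OF \<sigma>] nat_trans_in[OF \<tau>])
  fix a b f assume a: "a \<in> Obj C" "b \<in> Obj C" "f \<in> Hom C a b"
  note fa = functor_Obj[OF F a(1)] and fb = functor_Obj[OF F a(2)] and ga = functor_Obj[OF G a(1)]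
    and gb = functor_Obj[OF G a(2)] and ha = functor_Obj[OF H a(1)] and hb = functor_Obj[OF H a(2)]
  note Ff = functor_Arr[OF F a] and Gf = functor_Arr[OF G a] and Hf = functor_Arr[OF H a]
  note sa = nat_trans_in[OF \<sigma> a(1)] and sb = nat_trans_in[OF \<sigma> a(2)]
    and ta = nat_trans_in[OF \<tau> a(1)] and tb = nat_trans_in[OF \<tau> a(2)]
  have "Comp D (FObj F a) (FObj F b) (FObj H b)
      (Comp D (FObj F b) (FObj G b) (FObj H b) (\<tau> b) (\<sigma> b)) (FArr F a b f) =
    Comp D (FObj F a) (FObj G b) (FObj H b) (\<tau> b)
      (Comp D (FObj F a) (FObj F b) (FObj G b) (\<sigma> b) (FArr F a b f))"
    by (rule category_assoc[OF D fa fb gb hb Ff sb tb, symmetric])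
  also have "\<dots> = Comp D (FObj F a) (FObj G b) (FObj H b) (\<tau> b)
      (Comp D (FObj F a) (FObj G a) (FObj G b) (FArr G a b f) (\<sigma> a))"
    by (simp add: nat_trans_natural[OF \<sigma> a])
  also have "\<dots> = Comp D (FObj F a) (FObj G a) (FObj H b)
      (Comp D (FObj G a) (FObj G b) (FObj H b) (\<tau> b) (FArr G a b f)) (\<sigma> a)"
    by (rule category_assoc[OF D fa ga gb hb sa Gf tb])
  also have "\<dots> = Comp D (FObj F a) (FObj G a) (FObj H b)
      (Comp D (FObj G a) (FObj H a) (FObj H b) (FArr H a b f) (\<tau> a)) (\<sigma> a)"
    by (simp add: nat_trans_natural[OF \<tau> a])
  also have "\<dots> = Comp D (FObj F a) (FObj H a) (FObj H b) (FArr H a b f)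
      (Comp D (FObj F a) (FObj G a) (FObj H a) (\<tau> a) (\<sigma> a))"
    by (rule category_assoc[OF D fa ga ha hb sa ta Hf, symmetric])
  finally show "Comp D (FObj F a) (FObj F b) (FObj H b)
      ((\<lambda>a\<in>Obj C. Comp D (FObj F a) (FObj G a) (FObj H a) (\<tau> a) (\<sigma> a)) b) (FArr F a b f) =
    Comp D (FObj F a) (FObj H a) (FObj H b) (FArr H a b f)
      ((\<lambda>a\<in>Obj C. Comp D (FObj F a) (FObj G a) (FObj H a) (\<tau> a) (\<sigma> a)) a)"
    using a by simp
qed

lemma category_functor_cat: "category (functor_cat C D)"
  unfolding category_def
proof (intro conjI ballI)
  fix F assume "F \<in> Obj (functor_cat C D)"
  then show "Ident (functor_cat C D) F \<in> Hom (functor_cat C D) F F"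
    by (simp add: nat_trans_id_trans)
next
  fix F G H \<sigma> \<tau> assume "\<sigma> \<in> Hom (functor_cat C D) F G" "\<tau> \<in> Hom (functor_cat C D) G H"
  then show "Comp (functor_cat C D) F G H \<tau> \<sigma> \<in> Hom (functor_cat C D) F H"
    by (simp add: nat_trans_vcomp)
next
  fix F G \<sigma> assume "\<sigma> \<in> Hom (functor_cat C D) F G"
  then have \<sigma>: "nat_trans C D F G \<sigma>" by simp
  note F = nat_trans_functor(1)[OF \<sigma>] and G = nat_trans_functor(2)[OF \<sigma>]
  note D = functor_category(2)[OF F]
  have "Comp D (FObj F a) (FObj F a) (FObj G a) (\<sigma> a) (Ident D (FObj F a)) = \<sigma> a"
    "Comp D (FObj F a) (FObj G a) (FObj G a) (Ident D (FObj G a)) (\<sigma> a) = \<sigma> a" if "a \<in> Obj C" for a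
    using that by (auto intro!: category_Comp_Ident[OF D] category_Ident_Comp[OF D]
        functor_Obj[OF F] functor_Obj[OF G] nat_trans_in[OF \<sigma>])
  then show "Comp (functor_cat C D) F F G \<sigma> (Ident (functor_cat C D) F) = \<sigma>"
    "Comp (functor_cat C D) F G G (Ident (functor_cat C D) G) \<sigma> = \<sigma>"
    using nat_trans_extensional[OF \<sigma>] by (auto simp: id_trans_def extensional_def fun_eq_iff)
next
  fix F G H K \<sigma> \<tau> \<rho> assume "\<sigma> \<in> Hom (functor_cat C D) F G" "\<tau> \<in> Hom (functor_cat C D) G H"
    "\<rho> \<in> Hom (functor_cat C D) H K"
  then have n: "nat_trans C D F G \<sigma>" "nat_trans C D G H \<tau>" "nat_trans C D H K \<rho>" by simp_all
  note D = functor_category(2)[OF nat_trans_functor(1)[OF n(1)]]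
  show "Comp (functor_cat C D) F H K \<rho> (Comp (functor_cat C D) F G H \<tau> \<sigma>) =
      Comp (functor_cat C D) F G K (Comp (functor_cat C D) G H K \<rho> \<tau>) \<sigma>"
    by (auto simp: fun_eq_iff restrict_def intro!: category_assoc[OF D] nat_trans_in[OF n(1)] nat_trans_in[OF n(2)]
        nat_trans_in[OF n(3)] functor_Obj[OF nat_trans_functor(1)[OF n(1)]]
        functor_Obj[OF nat_trans_functor(2)[OF n(1)]]
        functor_Obj[OF nat_trans_functor(2)[OF n(2)]] functor_Obj[OF nat_trans_functor(2)[OF n(3)]])
qed

text \<open>Whisker a test transformation with \<open>N\<close>, solve the problem in
  \<open>P\<close>, and pull the solution back along the bijections on hom-sets. Naturality, the
  triangle and uniqueness are all tested after \<open>N\<close>, where faithfulness turns equal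
  images into equal arrows.\<close>

lemma fully_faithful_reflects_kan_extension:
  assumes kan: "is_left_kan_extension A B P K (N \<circ>\<^sub>F L \<circ>\<^sub>F K) (N \<circ>\<^sub>F L) (id_trans A P (N \<circ>\<^sub>F L \<circ>\<^sub>F K))"
    and N: "fully_faithful E P N" and L: "is_functor B E L"
  shows "is_left_kan_extension A B E K (L \<circ>\<^sub>F K) L (id_trans A E (L \<circ>\<^sub>F K))"
proof -
  have K: "is_functor A B K" using kan by (simp add: is_left_kan_extension_def)
  note LK = functor_comp_functor[OF L K]
  have NF: "is_functor E P N" using N by (simp add: fully_faithful_def)
  note E = functor_category(2)[OF L] and P = functor_category(2)[OF NF]
  have bij: "bij_betw (FArr N a b) (Hom E a b) (Hom P (FObj N a) (FObj N b))"
    if "a \<in> Obj E" "b \<in> Obj E" for a b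
    using N that by (simp add: fully_faithful_def)
  have inj: "f = g" if "a \<in> Obj E" "b \<in> Obj E" "f \<in> Hom E a b" "g \<in> Hom E a b"
    "FArr N a b f = FArr N a b g" for a b f g
    using bij[OF that(1,2)] that(3-5) by (auto simp: bij_betw_def dest: inj_onD)
  show ?thesis
    unfolding is_left_kan_extension_def
  proof (intro conjI allI impI, goal_cases)
    case 4
    show ?case by (rule nat_trans_id_trans[OF LK])
  next
    case (5 H \<alpha>)
    then have H: "is_functor B E H" and \<alpha>: "nat_trans A E (L \<circ>\<^sub>F K) (H \<circ>\<^sub>F K) \<alpha>" by auto
    note HK = functor_comp_functor[OF H K]
    define \<alpha>' where "\<alpha>' = (\<lambda>a\<in>Obj A. FArr N (FObj L (FObj K a)) (FObj H (FObj K a)) (\<alpha> a))"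
    \<comment> \<open>Stated for an arbitrary source category because it serves over
      \<open>A\<close> for \<alpha> and over \<open>B\<close> for a competing solution.\<close>
    have whisker: "nat_trans X P (N \<circ>\<^sub>F F) (N \<circ>\<^sub>F G) (\<lambda>a\<in>Obj X. FArr N (FObj F a) (FObj G a) (\<gamma> a))"
      if \<gamma>: "nat_trans X E F G \<gamma>" for X :: "('x, 'y) cat" and F G \<gamma>
    proof -
      note F = nat_trans_functor(1)[OF \<gamma>] and G = nat_trans_functor(2)[OF \<gamma>]
      show ?thesis
        unfolding nat_trans_def
      proof (intro conjI ballI functor_comp_functor[OF NF] F G)
        show "(\<lambda>a\<in>Obj X. FArr N (FObj F a) (FObj G a) (\<gamma> a))
            \<in> (\<Pi>\<^sub>E a\<in>Obj X. Hom P (FObj (N \<circ>\<^sub>F F) a) (FObj (N \<circ>\<^sub>F G) a))"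
          using nat_trans_in[OF \<gamma>] by (auto intro!: functor_Arr[OF NF] functor_Obj[OF F] functor_Obj[OF G])
        fix a b f assume a: "a \<in> Obj X" "b \<in> Obj X" "f \<in> Hom X a b"
        show "Comp P (FObj (N \<circ>\<^sub>F F) a) (FObj (N \<circ>\<^sub>F F) b) (FObj (N \<circ>\<^sub>F G) b)
            ((\<lambda>a\<in>Obj X. FArr N (FObj F a) (FObj G a) (\<gamma> a)) b) (FArr (N \<circ>\<^sub>F F) a b f) =
          Comp P (FObj (N \<circ>\<^sub>F F) a) (FObj (N \<circ>\<^sub>F G) a) (FObj (N \<circ>\<^sub>F G) b)
            (FArr (N \<circ>\<^sub>F G) a b f) ((\<lambda>a\<in>Obj X. FArr N (FObj F a) (FObj G a) (\<gamma> a)) a)"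
          using a nat_trans_natural[OF \<gamma> a]
            functor_Comp[OF NF functor_Obj[OF F a(1)] functor_Obj[OF F a(2)] functor_Obj[OF G a(2)]
              functor_Arr[OF F a] nat_trans_in[OF \<gamma> a(2)]]
            functor_Comp[OF NF functor_Obj[OF F a(1)] functor_Obj[OF G a(1)] functor_Obj[OF G a(2)]
              nat_trans_in[OF \<gamma> a(1)] functor_Arr[OF G a]]
          by simp
      qed
    qed
    have \<alpha>': "nat_trans A P (N \<circ>\<^sub>F L \<circ>\<^sub>F K) ((N \<circ>\<^sub>F H) \<circ>\<^sub>F K) \<alpha>'"
      using whisker[OF \<alpha>] by (simp add: \<alpha>'_def comp_functor_assoc)
    \<comment> \<open>The unit is an identity transformation, so the triangle condition collapses:
      it just prescribes the component at \<open>FObj K a\<close>.\<close>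
    have unit: "Comp X (FObj (F \<circ>\<^sub>F K) a) (FObj F (FObj K a)) (FObj G (FObj K a)) (\<gamma> (FObj K a))
        (id_trans A X (F \<circ>\<^sub>F K) a) = \<gamma> (FObj K a)"
      if \<gamma>: "nat_trans B X F G \<gamma>" and a: "a \<in> Obj A" for X :: "('x, 'y) cat" and F G \<gamma> a
    proof -
      note Ka = functor_Obj[OF K a]
      show ?thesis
        using a category_Comp_Ident[OF functor_category(2)[OF nat_trans_functor(1)[OF \<gamma>]]
          functor_Obj[OF nat_trans_functor(1)[OF \<gamma>] Ka] functor_Obj[OF nat_trans_functor(2)[OF \<gamma>] Ka]
          nat_trans_in[OF \<gamma> Ka]] by (simp add: id_trans_def)
    qed
    have NL_unit: "Comp P (FObj (N \<circ>\<^sub>F L \<circ>\<^sub>F K) a) (FObj (N \<circ>\<^sub>F L) (FObj K a))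
        (FObj (N \<circ>\<^sub>F H) (FObj K a)) (\<gamma> (FObj K a)) (id_trans A P (N \<circ>\<^sub>F L \<circ>\<^sub>F K) a) = \<gamma> (FObj K a)"
      if "nat_trans B P (N \<circ>\<^sub>F L) (N \<circ>\<^sub>F H) \<gamma>" "a \<in> Obj A" for \<gamma> a
      using unit[OF that] by (simp add: comp_functor_assoc)
    have ex1: "\<exists>!\<beta>. nat_trans B P (N \<circ>\<^sub>F L) (N \<circ>\<^sub>F H) \<beta> \<and> (\<forall>a\<in>Obj A. \<beta> (FObj K a) = \<alpha>' a)"
    proof -
      have "\<exists>!\<beta>. nat_trans B P (N \<circ>\<^sub>F L) (N \<circ>\<^sub>F H) \<beta> \<and> (\<forall>a\<in>Obj A.
          Comp P (FObj (N \<circ>\<^sub>F L \<circ>\<^sub>F K) a) (FObj (N \<circ>\<^sub>F L) (FObj K a))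
            (FObj (N \<circ>\<^sub>F H) (FObj K a)) (\<beta> (FObj K a)) (id_trans A P (N \<circ>\<^sub>F L \<circ>\<^sub>F K) a) = \<alpha>' a)"
        using kan \<alpha>' functor_comp_functor[OF NF H] unfolding is_left_kan_extension_def by blast
      then show ?thesis using NL_unit by (metis (no_types, lifting))
    qed
    then obtain \<beta>' where \<beta>': "nat_trans B P (N \<circ>\<^sub>F L) (N \<circ>\<^sub>F H) \<beta>'"
      "\<And>a. a \<in> Obj A \<Longrightarrow> \<beta>' (FObj K a) = \<alpha>' a" by blast
    \<comment> \<open>Fullness gives each component of \<open>\<beta>'\<close> a preimage;
      restricting to \<open>Obj B\<close> keeps \<beta> extensional, as \<open>nat_trans\<close>
      demands.\<close>
    define \<beta> where "\<beta> = (\<lambda>b\<in>Obj B. inv_into (Hom E (FObj L b) (FObj H b))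
      (FArr N (FObj L b) (FObj H b)) (\<beta>' b))"
    have \<beta>: "\<beta> b \<in> Hom E (FObj L b) (FObj H b)" "FArr N (FObj L b) (FObj H b) (\<beta> b) = \<beta>' b"
      if b: "b \<in> Obj B" for b
    proof -
      have "\<beta>' b \<in> FArr N (FObj L b) (FObj H b) ` Hom E (FObj L b) (FObj H b)"
        using nat_trans_in[OF \<beta>'(1) b] bij[OF functor_Obj[OF L b] functor_Obj[OF H b]]
        by (simp add: bij_betw_def)
      then show "\<beta> b \<in> Hom E (FObj L b) (FObj H b)" "FArr N (FObj L b) (FObj H b) (\<beta> b) = \<beta>' b"
        using b by (simp_all add: \<beta>_def inv_into_into f_inv_into_f)
    qed
    have \<beta>_nat: "nat_trans B E L H \<beta>"
      unfolding nat_trans_def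
    proof (intro conjI ballI L H)
      show "\<beta> \<in> (\<Pi>\<^sub>E a\<in>Obj B. Hom E (FObj L a) (FObj H a))"
        using \<beta>(1) by (auto simp: \<beta>_def)
      fix a b f assume a: "a \<in> Obj B" "b \<in> Obj B" "f \<in> Hom B a b"
      note La = functor_Obj[OF L a(1)] and Lb = functor_Obj[OF L a(2)] and Ha = functor_Obj[OF H a(1)]
        and Hb = functor_Obj[OF H a(2)] and Lf = functor_Arr[OF L a] and Hf = functor_Arr[OF H a]
      show "Comp E (FObj L a) (FObj L b) (FObj H b) (\<beta> b) (FArr L a b f) =
          Comp E (FObj L a) (FObj H a) (FObj H b) (FArr H a b f) (\<beta> a)"
      proof (rule inj[OF La Hb category_Comp[OF E La Lb Hb Lf \<beta>(1)[OF a(2)]]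
            category_Comp[OF E La Ha Hb \<beta>(1)[OF a(1)] Hf]])
        show "FArr N (FObj L a) (FObj H b) (Comp E (FObj L a) (FObj L b) (FObj H b) (\<beta> b) (FArr L a b f)) =
          FArr N (FObj L a) (FObj H b) (Comp E (FObj L a) (FObj H a) (FObj H b) (FArr H a b f) (\<beta> a))"
          using nat_trans_natural[OF \<beta>'(1) a]
          by (simp add: functor_Comp[OF NF La Lb Hb Lf \<beta>(1)[OF a(2)]]
              functor_Comp[OF NF La Ha Hb \<beta>(1)[OF a(1)] Hf] \<beta>(2) a)
      qed
    qed
    have "\<exists>!\<beta>. nat_trans B E L H \<beta> \<and> (\<forall>a\<in>Obj A. \<beta> (FObj K a) = \<alpha> a)"
    proof (rule ex1I[of _ \<beta>], intro conjI ballI \<beta>_nat)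
      fix a assume a: "a \<in> Obj A"
      note Ka = functor_Obj[OF K a]
      show "\<beta> (FObj K a) = \<alpha> a"
        using inj[OF functor_Obj[OF L Ka] functor_Obj[OF H Ka] \<beta>(1)[OF Ka], of "\<alpha> a"]
          nat_trans_in[OF \<alpha> a] \<beta>(2)[OF Ka] \<beta>'(2)[OF a] a by (simp add: \<alpha>'_def)
    next
      fix \<gamma> assume \<gamma>: "nat_trans B E L H \<gamma> \<and> (\<forall>a\<in>Obj A. \<gamma> (FObj K a) = \<alpha> a)"
      \<comment> \<open>After whiskering, the competitor \<gamma> solves the same problem in
        \<open>P\<close> as \<open>\<beta>'\<close>, and that problem has only one solution.\<close>
      have eq: "(\<lambda>a\<in>Obj B. FArr N (FObj L a) (FObj H a) (\<gamma> a)) = \<beta>'"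
        using ex1 \<beta>' whisker[OF conjunct1[OF \<gamma>]] \<gamma>
        by (elim ex1E) (smt (verit, best) K \<alpha>'_def functor_Obj restrict_apply')
      have "\<gamma> b = \<beta> b" for b
      proof (cases "b \<in> Obj B")
        case True
        show ?thesis
          using inj[OF functor_Obj[OF L True] functor_Obj[OF H True] _ \<beta>(1)[OF True], of "\<gamma> b"]
            \<beta>(2)[OF True] fun_cong[OF eq, of b] True nat_trans_in[OF conjunct1[OF \<gamma>] True] by simp
      next
        case False
        then show ?thesis
          using nat_trans_extensional[OF conjunct1[OF \<gamma>]] by (simp add: extensional_def \<beta>_def)
      qed
      then show "\<gamma> = \<beta>" by auto
    qed
    then show ?case using unit by (metis (no_types, lifting))
  qed (use K L LK in auto)
qed

section \<open>Presheaves and nerves\<close>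

lemma presheaf_functor_in:
  assumes H: "is_functor B (presheaf_cat S C) H" and "a \<in> Obj B" "b \<in> Obj B" "g \<in> Hom B a b"
    and "c \<in> Obj C" "z \<in> FObj (FObj H a) c"
  shows "FArr H a b g c z \<in> FObj (FObj H b) c"
proof -
  have "nat_trans (op_cat C) (set_cat S) (FObj H a) (FObj H b) (FArr H a b g)"
    using functor_Arr[OF assms(1-4)] by (simp add: presheaf_cat_def)
  from nat_trans_in[OF this, of c] show ?thesis using assms(5,6) by (auto simp: PiE_iff)
qed

lemma presheaf_functor_Comp:
  assumes H: "is_functor B (presheaf_cat S C) H" and "a \<in> Obj B" "b \<in> Obj B" "b' \<in> Obj B"
    "f \<in> Hom B a b" "g \<in> Hom B b b'" and "c \<in> Obj C" "z \<in> FObj (FObj H a) c"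
  shows "FArr H a b' (Comp B a b b' g f) c z = FArr H b b' g c (FArr H a b f c z)"
  using functor_Comp[OF assms(1-6)] assms(7,8) by (simp add: presheaf_cat_def compose_def)

lemma presheaf_functor_Ident:
  assumes H: "is_functor B (presheaf_cat S C) H" and "a \<in> Obj B"
    and "c \<in> Obj C" "z \<in> FObj (FObj H a) c"
  shows "FArr H a a (Ident B a) c z = z"
  using functor_Ident[OF assms(1,2)] assms(3,4) by (simp add: presheaf_cat_def id_trans_def)

lemma presheaf_nat_trans_in:
  assumes \<alpha>: "nat_trans A (presheaf_cat S C) F G \<alpha>" and "a \<in> Obj A" "c \<in> Obj C"
    and "z \<in> FObj (FObj F a) c"
  shows "\<alpha> a c z \<in> FObj (FObj G a) c"
proof -
  have "nat_trans (op_cat C) (set_cat S) (FObj F a) (FObj G a) (\<alpha> a)"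
    using nat_trans_in[OF assms(1,2)] by (simp add: presheaf_cat_def)
  from nat_trans_in[OF this, of c] show ?thesis using assms(3,4) by (auto simp: PiE_iff)
qed

lemma presheaf_morphism_natural:
  assumes "nat_trans (op_cat C) (set_cat S) X Y \<tau>" and c: "c \<in> Obj C" "c' \<in> Obj C"
    and f: "f \<in> Hom C c' c" and z: "z \<in> FObj X c"
  shows "\<tau> c' (FArr X c c' f z) = FArr Y c c' f (\<tau> c z)"
  using nat_trans_natural[OF assms(1), of c c' f] c f z
  by (auto simp: compose_def fun_eq_iff split: if_splits)

lemma presheaf_nat_trans_natural:
  assumes \<alpha>: "nat_trans A (presheaf_cat S C) F G \<alpha>" and a: "a \<in> Obj A" "b \<in> Obj A" "f \<in> Hom A a b"
    and c: "c \<in> Obj C" and z: "z \<in> FObj (FObj F a) c"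
  shows "\<alpha> b c (FArr F a b f c z) = FArr G a b f c (\<alpha> a c z)"
  using fun_cong[OF fun_cong[OF nat_trans_natural[OF assms(1-4)], of c], of z] c z
  by (simp add: presheaf_cat_def compose_def)

lemma presheaf_nat_trans_extensional:
  assumes \<alpha>: "nat_trans A (presheaf_cat S C) F G \<alpha>"
  shows "\<alpha> \<in> extensional (Obj A)" "a \<in> Obj A \<Longrightarrow> \<alpha> a \<in> extensional (Obj C)"
    "a \<in> Obj A \<Longrightarrow> c \<in> Obj C \<Longrightarrow> \<alpha> a c \<in> extensional (FObj (FObj F a) c)"
proof -
  show "\<alpha> \<in> extensional (Obj A)" by (rule nat_trans_extensional[OF \<alpha>])
  assume a: "a \<in> Obj A"
  then have *: "nat_trans (op_cat C) (set_cat S) (FObj F a) (FObj G a) (\<alpha> a)"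
    using nat_trans_in[OF \<alpha> a] by (simp add: presheaf_cat_def)
  show "\<alpha> a \<in> extensional (Obj C)" using nat_trans_extensional[OF *] by simp
  assume c: "c \<in> Obj C"
  show "\<alpha> a c \<in> extensional (FObj (FObj F a) c)" using nat_trans_in[OF *, of c] c by (simp add: PiE_def)
qed

text \<open>Equality here is HOL equality of functions of three arguments, so besides agreement on
  elements it takes extensionality in the object, in the stage \<open>c\<close> and in the
  element.\<close>

lemma presheaf_nat_trans_eqI:
  assumes \<alpha>: "nat_trans A (presheaf_cat S C) F G \<alpha>" and \<beta>: "nat_trans A (presheaf_cat S C) F G \<beta>"
    and eq: "\<And>a c z. a \<in> Obj A \<Longrightarrow> c \<in> Obj C \<Longrightarrow> z \<in> FObj (FObj F a) c \<Longrightarrow> \<alpha> a c z = \<beta> a c z"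
  shows "\<alpha> = \<beta>"
proof (rule extensionalityI[OF presheaf_nat_trans_extensional(1)[OF \<alpha>] presheaf_nat_trans_extensional(1)[OF \<beta>]])
  fix a assume a: "a \<in> Obj A"
  show "\<alpha> a = \<beta> a"
  proof (rule extensionalityI[OF presheaf_nat_trans_extensional(2)[OF \<alpha> a]
        presheaf_nat_trans_extensional(2)[OF \<beta> a]])
    fix c assume c: "c \<in> Obj C"
    show "\<alpha> a c = \<beta> a c"
      by (rule extensionalityI[OF presheaf_nat_trans_extensional(3)[OF \<alpha> a c]
        presheaf_nat_trans_extensional(3)[OF \<beta> a c]]) (rule eq[OF a c])
  qed
qed

lemma presheaf_morphismI:
  assumes "is_functor (op_cat C) (set_cat S) X" "is_functor (op_cat C) (set_cat S) Y"
    and "\<tau> \<in> extensional (Obj C)" "\<And>c. c \<in> Obj C \<Longrightarrow> \<tau> c \<in> FObj X c \<rightarrow>\<^sub>E FObj Y c"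
    and nat: "\<And>c c' f z. c \<in> Obj C \<Longrightarrow> c' \<in> Obj C \<Longrightarrow> f \<in> Hom C c' c \<Longrightarrow> z \<in> FObj X c \<Longrightarrow>
      \<tau> c' (FArr X c c' f z) = FArr Y c c' f (\<tau> c z)"
  shows "nat_trans (op_cat C) (set_cat S) X Y \<tau>"
  using assms unfolding nat_trans_def by (auto simp: compose_def fun_eq_iff PiE_iff)

text \<open>Such a transformation carries two naturality conditions: in the stage, which makes each
  component a morphism of presheaves, and in the base category \<open>A\<close>. The rule separates
  them and states both on elements.\<close>

lemma presheaf_nat_transI:
  assumes F: "is_functor A (presheaf_cat S C) F" and G: "is_functor A (presheaf_cat S C) G"
    and "\<alpha> \<in> extensional (Obj A)" "\<And>a. a \<in> Obj A \<Longrightarrow> \<alpha> a \<in> extensional (Obj C)"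
    and "\<And>a c. a \<in> Obj A \<Longrightarrow> c \<in> Obj C \<Longrightarrow> \<alpha> a c \<in> FObj (FObj F a) c \<rightarrow>\<^sub>E FObj (FObj G a) c"
    and "\<And>a c c' f z. a \<in> Obj A \<Longrightarrow> c \<in> Obj C \<Longrightarrow> c' \<in> Obj C \<Longrightarrow> f \<in> Hom C c' c \<Longrightarrow>
      z \<in> FObj (FObj F a) c \<Longrightarrow> \<alpha> a c' (FArr (FObj F a) c c' f z) = FArr (FObj G a) c c' f (\<alpha> a c z)"
    and nat: "\<And>a b f c z. a \<in> Obj A \<Longrightarrow> b \<in> Obj A \<Longrightarrow> f \<in> Hom A a b \<Longrightarrow> c \<in> Obj C \<Longrightarrow>
      z \<in> FObj (FObj F a) c \<Longrightarrow> \<alpha> b c (FArr F a b f c z) = FArr G a b f c (\<alpha> a c z)"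
  shows "nat_trans A (presheaf_cat S C) F G \<alpha>"
  unfolding nat_trans_def
proof (intro conjI ballI F G)
  have "nat_trans (op_cat C) (set_cat S) (FObj F a) (FObj G a) (\<alpha> a)" if a: "a \<in> Obj A" for a
    using functor_Obj[OF F a] functor_Obj[OF G a] assms(4-6)[OF a]
    by (intro presheaf_morphismI) (auto simp: presheaf_cat_def)
  then show "\<alpha> \<in> (\<Pi>\<^sub>E a\<in>Obj A. Hom (presheaf_cat S C) (FObj F a) (FObj G a))"
    using assms(3) by (auto simp: presheaf_cat_def PiE_iff)
  fix a b f assume "a \<in> Obj A" "b \<in> Obj A" "f \<in> Hom A a b"
  with nat[OF this] show "Comp (presheaf_cat S C) (FObj F a) (FObj F b) (FObj G b) (\<alpha> b) (FArr F a b f) =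
    Comp (presheaf_cat S C) (FObj F a) (FObj G a) (FObj G b) (FArr G a b f) (\<alpha> a)"
    by (auto simp: presheaf_cat_def compose_def fun_eq_iff restrict_def)
qed

section \<open>The nerve along a functor with small hom-sets out of its image\<close>

text \<open>These assumptions make the nerve a functor into presheaves. Density is not among them,
  because the locale is used to prove density of the linear graphs.\<close>

locale nerve_context =
  fixes S :: "'u set set" and C :: "('o, 'a) cat" and D :: "('p, 'b) cat"
    and i :: "('o, 'a, 'p, 'b) ftor"
  assumes i_functor: "is_functor C D i"
    and small: "\<And>c d. c \<in> Obj C \<Longrightarrow> d \<in> Obj D \<Longrightarrow> small_set S (Hom D (FObj i c) d)"
begin

abbreviation "code c d \<equiv> hom_code S D (FObj i c) d"
abbreviation "N \<equiv> nerve S C D i"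

lemma C: "category C" and D: "category D"
  using i_functor by (auto dest: functor_category)

lemma i_Obj: "c \<in> Obj C \<Longrightarrow> FObj i c \<in> Obj D"
  by (rule functor_Obj[OF i_functor])

lemma i_Arr: "c \<in> Obj C \<Longrightarrow> c' \<in> Obj C \<Longrightarrow> f \<in> Hom C c c' \<Longrightarrow> FArr i c c' f \<in> Hom D (FObj i c) (FObj i c')"
  by (rule functor_Arr[OF i_functor])

lemma decode_code:
  "c \<in> Obj C \<Longrightarrow> d \<in> Obj D \<Longrightarrow> h \<in> Hom D (FObj i c) d \<Longrightarrow>
    hom_decode S D (FObj i c) d (code c d h) = h"
  unfolding hom_decode_def by (rule inv_into_f_f[OF hom_code(1)[OF small]])

lemma code_inj:
  assumes "c \<in> Obj C" "d \<in> Obj D" "h \<in> Hom D (FObj i c) d" "h' \<in> Hom D (FObj i c) d"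
    "code c d h = code c d h'"
  shows "h = h'"
  using assms decode_code by metis

lemma nerve_FObj: "c \<in> Obj C \<Longrightarrow> FObj (FObj N d) c = code c d ` Hom D (FObj i c) d"
  by (simp add: nerve_def nerve_obj_def restrict_functor_def hom_obj_def)

lemma nerve_obj_FArr:
  assumes "c \<in> Obj C" "c' \<in> Obj C" "f \<in> Hom C c' c" "d \<in> Obj D" "h \<in> Hom D (FObj i c) d"
  shows "FArr (FObj N d) c c' f (code c d h) =
    code c' d (Comp D (FObj i c') (FObj i c) d h (FArr i c' c f))"
  using assms by (simp add: nerve_def nerve_obj_def restrict_functor_def hom_obj_def decode_code)

lemma nerve_FArr:
  assumes "c \<in> Obj C" "d \<in> Obj D" "h \<in> Hom D (FObj i c) d"
  shows "FArr N d d' g c (code c d h) = code c d' (Comp D (FObj i c) d d' g h)"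
  using assms by (simp add: nerve_def hom_obj_def decode_code)

lemma nerve_obj_FArr_extensional:
  assumes "c \<in> Obj C" "c' \<in> Obj C" "f \<in> Hom C c' c"
  shows "FArr (FObj N d) c c' f \<in> extensional (FObj (FObj N d) c)"
  using assms by (simp add: nerve_def nerve_obj_def restrict_functor_def)

lemma Comp_i_in:
  assumes "c \<in> Obj C" "c' \<in> Obj C" "f \<in> Hom C c' c" "d \<in> Obj D" "h \<in> Hom D (FObj i c) d"
  shows "Comp D (FObj i c') (FObj i c) d h (FArr i c' c f) \<in> Hom D (FObj i c') d"
  using assms by (intro category_Comp[OF D] i_Obj i_Arr)

lemma nerve_obj_functor:
  assumes d: "d \<in> Obj D"
  shows "is_functor (op_cat C) (set_cat S) (FObj N d)"
  unfolding is_functor_def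
proof (intro conjI ballI category_op_cat[OF C] category_set_cat, simp_all)
  fix c assume c: "c \<in> Obj C"
  show "FObj (FObj N d) c \<in> S"
    using hom_code(2)[OF small[OF c d]] c by (simp add: nerve_FObj hom_obj_def)
  show "FArr (FObj N d) c c (Ident C c) = (\<lambda>x\<in>FObj (FObj N d) c. x)"
  proof (rule extensionalityI[OF nerve_obj_FArr_extensional])
    fix x assume "x \<in> FObj (FObj N d) c"
    then obtain h where "x = code c d h" "h \<in> Hom D (FObj i c) d" using c by (auto simp: nerve_FObj)
    then show "FArr (FObj N d) c c (Ident C c) x = (\<lambda>x\<in>FObj (FObj N d) c. x) x"
      using c d by (simp add: nerve_obj_FArr nerve_FObj category_Ident[OF C] functor_Ident[OF i_functor]
          category_Comp_Ident[OF D] i_Obj)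
  qed (use c category_Ident[OF C] in auto)
next
  fix c c' f assume c: "c \<in> Obj C" "c' \<in> Obj C" "f \<in> Hom C c' c"
  show "FArr (FObj N d) c c' f \<in> FObj (FObj N d) c \<rightarrow>\<^sub>E FObj (FObj N d) c'"
    using nerve_obj_FArr_extensional[OF c, of d] c d Comp_i_in[OF c d]
    by (auto simp: PiE_iff nerve_FObj nerve_obj_FArr)
next
  fix c c' c'' f g assume c: "c \<in> Obj C" "c' \<in> Obj C" "c'' \<in> Obj C" and f: "f \<in> Hom C c' c" "g \<in> Hom C c'' c'"
  note fg = category_Comp[OF C c(3,2,1) f(2,1)]
  show "FArr (FObj N d) c c'' (Comp C c'' c' c f g) =
      compose (FObj (FObj N d) c) (FArr (FObj N d) c' c'' g) (FArr (FObj N d) c c' f)"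
  proof (rule extensionalityI[OF nerve_obj_FArr_extensional[OF c(1,3) fg] compose_extensional])
    fix x assume x: "x \<in> FObj (FObj N d) c"
    then obtain h where h: "x = code c d h" "h \<in> Hom D (FObj i c) d" using c by (auto simp: nerve_FObj)
    show "FArr (FObj N d) c c'' (Comp C c'' c' c f g) x =
        compose (FObj (FObj N d) c) (FArr (FObj N d) c' c'' g) (FArr (FObj N d) c c' f) x"
      using x c d f h fg
        category_assoc[OF D i_Obj[OF c(3)] i_Obj[OF c(2)] i_Obj[OF c(1)] d i_Arr[OF c(3,2) f(2)]
          i_Arr[OF c(2,1) f(1)] h(2)]
      by (simp add: compose_def nerve_obj_FArr Comp_i_in functor_Comp[OF i_functor c(3,2,1) f(2,1)])
  qed
qed

lemma nerve_Obj:
  assumes d: "d \<in> Obj D"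
  shows "FObj N d \<in> Obj (presheaf_cat S C)"
  using nerve_obj_functor[OF d]
  by (auto simp: presheaf_cat_def ext_functor_def nerve_def nerve_obj_def restrict_functor_def)

lemma nerve_FArr_nat_trans:
  assumes d: "d \<in> Obj D" "d' \<in> Obj D" and g: "g \<in> Hom D d d'"
  shows "nat_trans (op_cat C) (set_cat S) (FObj N d) (FObj N d') (FArr N d d' g)"
proof (rule presheaf_morphismI[OF nerve_obj_functor[OF d(1)] nerve_obj_functor[OF d(2)]])
  show "FArr N d d' g \<in> extensional (Obj C)" by (simp add: nerve_def)
next
  fix c assume c: "c \<in> Obj C"
  have "FArr N d d' g c \<in> extensional (FObj (FObj N d) c)"
    using c by (simp add: nerve_def nerve_obj_def restrict_functor_def)
  moreover have "Comp D (FObj i c) d d' g h \<in> Hom D (FObj i c) d'" if "h \<in> Hom D (FObj i c) d" for h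
    by (rule category_Comp[OF D i_Obj[OF c] d that g])
  ultimately show "FArr N d d' g c \<in> FObj (FObj N d) c \<rightarrow>\<^sub>E FObj (FObj N d') c"
    using c d by (auto simp: PiE_iff nerve_FObj nerve_FArr)
next
  fix c c' f z assume c: "c \<in> Obj C" "c' \<in> Obj C" "f \<in> Hom C c' c" and "z \<in> FObj (FObj N d) c"
  then obtain h where h: "z = code c d h" "h \<in> Hom D (FObj i c) d" by (auto simp: nerve_FObj)
  show "FArr N d d' g c' (FArr (FObj N d) c c' f z) = FArr (FObj N d') c c' f (FArr N d d' g c z)"
    using c d h category_Comp[OF D i_Obj[OF c(1)] d h(2) g]
      category_assoc[OF D i_Obj[OF c(2)] i_Obj[OF c(1)] d i_Arr[OF c(2,1,3)] h(2) g]
    by (simp add: nerve_obj_FArr nerve_FArr Comp_i_in)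
qed

lemma nerve_functor: "is_functor D (presheaf_cat S C) N"
  unfolding is_functor_def
proof (intro conjI ballI D nerve_Obj)
  show "category (presheaf_cat S C)" by (simp add: presheaf_cat_def category_functor_cat)
next
  fix d d' g assume "d \<in> Obj D" "d' \<in> Obj D" "g \<in> Hom D d d'"
  then show "FArr N d d' g \<in> Hom (presheaf_cat S C) (FObj N d) (FObj N d')"
    by (simp add: presheaf_cat_def nerve_FArr_nat_trans)
next
  fix d assume d: "d \<in> Obj D"
  have "(\<lambda>x\<in>hom_obj S D (FObj i c) d. code c d (Comp D (FObj i c) d d (Ident D d)
       (hom_decode S D (FObj i c) d x))) = (\<lambda>x\<in>hom_obj S D (FObj i c) d. x)" if c: "c \<in> Obj C" for c
    using c d category_Ident_Comp[OF D i_Obj[OF c] d] decode_code[OF c d]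
    by (auto simp: hom_obj_def fun_eq_iff)
  then show "FArr N d d (Ident D d) = Ident (presheaf_cat S C) (FObj N d)"
    by (auto simp: presheaf_cat_def id_trans_def nerve_def nerve_obj_def restrict_functor_def fun_eq_iff)
next
  fix a b d f g assume a: "a \<in> Obj D" "b \<in> Obj D" "d \<in> Obj D" and f: "f \<in> Hom D a b" "g \<in> Hom D b d"
  have eq: "FArr N a d (Comp D a b d g f) c x = FArr N b d g c (FArr N a b f c x)"
    if c: "c \<in> Obj C" and x: "x \<in> FObj (FObj N a) c" for c x
  proof -
    obtain h where h: "x = code c a h" "h \<in> Hom D (FObj i c) a" using c x by (auto simp: nerve_FObj)
    then show ?thesis
      using a c category_Comp[OF D i_Obj[OF c] a(1,2) h(2) f(1)]
        category_assoc[OF D i_Obj[OF c] a h(2) f] by (simp add: nerve_FArr)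
  qed
  have ext: "FArr N a d (Comp D a b d g f) c \<in> extensional (FObj (FObj N a) c)" if "c \<in> Obj C" for c
    using that by (simp add: nerve_def nerve_obj_def restrict_functor_def)
  show "FArr N a d (Comp D a b d g f) =
      Comp (presheaf_cat S C) (FObj N a) (FObj N b) (FObj N d) (FArr N b d g) (FArr N a b f)"
    unfolding presheaf_cat_def functor_cat_simps
  proof (rule extensionalityI[where A = "Obj C"])
    fix c assume c: "c \<in> Obj C"
    show "FArr N a d (Comp D a b d g f) c = (\<lambda>c\<in>Obj (op_cat C). Comp (set_cat S) (FObj (FObj N a) c)
        (FObj (FObj N b) c) (FObj (FObj N d) c) (FArr N b d g c) (FArr N a b f c)) c"
      using c eq[OF c] ext[OF c] by (auto simp: compose_def fun_eq_iff extensional_def)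
  qed (simp_all add: nerve_def)
qed

text \<open>
  A generic factorization is an initial object of the category of factorizations of \<open>x\<close> through
  arrows \<open>T u\<close> with \<open>u : K k \<rightarrow> b\<close>; in particular that category is connected, so the colimit formula
  for the Kan extension holds elementwise.
\<close>

lemma nerve_left_kan_extension:
  assumes K: "is_functor C' B K" and T: "is_functor B D T"
    and generic: "\<And>c b x. c \<in> Obj C \<Longrightarrow> b \<in> Obj B \<Longrightarrow> x \<in> Hom D (FObj i c) (FObj T b) \<Longrightarrow>
      \<exists>k\<in>Obj C'. \<exists>u\<in>Hom B (FObj K k) b. \<exists>y\<in>Hom D (FObj i c) (FObj T (FObj K k)).
        x = Comp D (FObj i c) (FObj T (FObj K k)) (FObj T b) (FArr T (FObj K k) b u) y \<and>
        (\<forall>k'\<in>Obj C'. \<forall>u'\<in>Hom B (FObj K k') b. \<forall>y'\<in>Hom D (FObj i c) (FObj T (FObj K k')).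
          x = Comp D (FObj i c) (FObj T (FObj K k')) (FObj T b) (FArr T (FObj K k') b u') y' \<longrightarrow>
          (\<exists>j\<in>Hom C' k k'. Comp B (FObj K k) (FObj K k') b u' (FArr K k k' j) = u \<and>
             Comp D (FObj i c) (FObj T (FObj K k)) (FObj T (FObj K k'))
               (FArr T (FObj K k) (FObj K k') (FArr K k k' j)) y = y'))"
  shows "is_left_kan_extension C' B (presheaf_cat S C) K (N \<circ>\<^sub>F T \<circ>\<^sub>F K) (N \<circ>\<^sub>F T)
    (id_trans C' (presheaf_cat S C) (N \<circ>\<^sub>F T \<circ>\<^sub>F K))"
proof -
  let ?P = "presheaf_cat S C"
  note NT = functor_comp_functor[OF nerve_functor T]
  have NTK: "is_functor C' ?P (N \<circ>\<^sub>F T \<circ>\<^sub>F K)"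
    using functor_comp_functor[OF NT K] by (simp add: comp_functor_assoc)
  note TO = functor_Obj[OF T] and KO = functor_Obj[OF K]
  note B = functor_category(1)[OF T] and C' = functor_category(1)[OF K]
  have "\<exists>!\<beta>. nat_trans B ?P (N \<circ>\<^sub>F T) H \<beta> \<and> (\<forall>a\<in>Obj C'. Comp ?P (FObj (N \<circ>\<^sub>F T \<circ>\<^sub>F K) a)
      (FObj (N \<circ>\<^sub>F T) (FObj K a)) (FObj H (FObj K a)) (\<beta> (FObj K a))
      (id_trans C' ?P (N \<circ>\<^sub>F T \<circ>\<^sub>F K) a) = \<alpha> a)"
    if H: "is_functor B ?P H" and \<alpha>: "nat_trans C' ?P (N \<circ>\<^sub>F T \<circ>\<^sub>F K) (H \<circ>\<^sub>F K) \<alpha>" for H \<alpha>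
  proof -
    have unit: "Comp ?P (FObj (N \<circ>\<^sub>F T \<circ>\<^sub>F K) a) (FObj (N \<circ>\<^sub>F T) (FObj K a)) (FObj H (FObj K a))
        (\<beta> (FObj K a)) (id_trans C' ?P (N \<circ>\<^sub>F T \<circ>\<^sub>F K) a) = \<beta> (FObj K a)"
      if \<beta>: "nat_trans B ?P (N \<circ>\<^sub>F T) H \<beta>" and a: "a \<in> Obj C'" for \<beta> a
      using a category_Comp_Ident[OF functor_category(2)[OF H] functor_Obj[OF NT KO[OF a]]
          functor_Obj[OF H KO[OF a]] nat_trans_in[OF \<beta> KO[OF a]]] by (simp add: id_trans_def)
    define fact where "fact c b x k u y \<longleftrightarrow> k \<in> Obj C' \<and> u \<in> Hom B (FObj K k) b \<and>
      y \<in> Hom D (FObj i c) (FObj T (FObj K k)) \<and>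
      x = Comp D (FObj i c) (FObj T (FObj K k)) (FObj T b) (FArr T (FObj K k) b u) y" for c b x k u y
    define val where "val c b k u y = FArr H (FObj K k) b u c (\<alpha> k c (code c (FObj T (FObj K k)) y))"
      for c b k u y
    have \<alpha>_in: "\<alpha> k c (code c (FObj T (FObj K k)) y) \<in> FObj (FObj H (FObj K k)) c"
      if "k \<in> Obj C'" "c \<in> Obj C" "y \<in> Hom D (FObj i c) (FObj T (FObj K k))" for k c y
      using presheaf_nat_trans_in[OF \<alpha> that(1,2)] that by (auto simp: nerve_FObj)
    have \<alpha>_nat: "\<alpha> k' c (code c (FObj T (FObj K k')) (Comp D (FObj i c) (FObj T (FObj K k)) (FObj T (FObj K k'))
          (FArr T (FObj K k) (FObj K k') (FArr K k k' j)) y)) =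
        FArr H (FObj K k) (FObj K k') (FArr K k k' j) c (\<alpha> k c (code c (FObj T (FObj K k)) y))"
      if "k \<in> Obj C'" "k' \<in> Obj C'" "j \<in> Hom C' k k'" "c \<in> Obj C"
        "y \<in> Hom D (FObj i c) (FObj T (FObj K k))" for k k' j c y
      using presheaf_nat_trans_natural[OF \<alpha> that(1-4), of "code c (FObj T (FObj K k)) y"] that
      by (simp add: nerve_FObj nerve_FArr TO KO)
    have ex_fact: "\<exists>k u y. fact c b x k u y"
      and val_unique: "\<And>k u y k' u' y'. fact c b x k u y \<Longrightarrow> fact c b x k' u' y' \<Longrightarrow>
        val c b k u y = val c b k' u' y'"
      if c: "c \<in> Obj C" and b: "b \<in> Obj B" and x: "x \<in> Hom D (FObj i c) (FObj T b)" for c b x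
    proof -
      from generic[OF that] obtain k u y where g: "fact c b x k u y"
        and init: "\<And>k' u' y'. fact c b x k' u' y' \<Longrightarrow>
          (\<exists>j\<in>Hom C' k k'. Comp B (FObj K k) (FObj K k') b u' (FArr K k k' j) = u \<and>
             Comp D (FObj i c) (FObj T (FObj K k)) (FObj T (FObj K k'))
               (FArr T (FObj K k) (FObj K k') (FArr K k k' j)) y = y')"
        unfolding fact_def by metis
      show "\<exists>k u y. fact c b x k u y" using g by blast
      \<comment> \<open>The comparison arrow \<open>j\<close> leads out of the generic
        factorization. Naturality of \<alpha> along \<open>j\<close> expresses the value at
        \<open>y'\<close> by the one at \<open>y\<close>, and functoriality of \<open>H\<close>
        merges \<open>u'\<close> and \<open>K j\<close> into \<open>u\<close>.\<close>
      have "val c b k' u' y' = val c b k u y" if f: "fact c b x k' u' y'" for k' u' y'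
      proof -
        obtain j where j: "j \<in> Hom C' k k'" "Comp B (FObj K k) (FObj K k') b u' (FArr K k k' j) = u"
          "Comp D (FObj i c) (FObj T (FObj K k)) (FObj T (FObj K k'))
               (FArr T (FObj K k) (FObj K k') (FArr K k k' j)) y = y'" using init[OF f] by blast
        have k: "k \<in> Obj C'" "k' \<in> Obj C'" "y \<in> Hom D (FObj i c) (FObj T (FObj K k))"
          "u' \<in> Hom B (FObj K k') b" using f g by (auto simp: fact_def)
        show ?thesis
          unfolding val_def j(3)[symmetric] \<alpha>_nat[OF k(1,2) j(1) c k(3)] j(2)[symmetric]
          by (rule presheaf_functor_Comp[OF H KO[OF k(1)] KO[OF k(2)] b functor_Arr[OF K k(1,2) j(1)] k(4) c
                \<alpha>_in[OF k(1) c k(3)], symmetric])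
      qed
      then show "\<And>k u y k' u' y'. fact c b x k u y \<Longrightarrow> fact c b x k' u' y' \<Longrightarrow>
        val c b k u y = val c b k' u' y'" by metis
    qed
    have val_in: "val c b k u y \<in> FObj (FObj H b) c"
      if "c \<in> Obj C" "b \<in> Obj B" "fact c b x k u y" for c b x k u y
      using that presheaf_functor_in[OF H KO _ _ _ \<alpha>_in] by (auto simp: fact_def val_def)
    \<comment> \<open>The choice is harmless: by \<open>val_unique\<close> all factorizations of the
      decoded arrow give the same value.\<close>
    define \<beta> where "\<beta> = (\<lambda>b\<in>Obj B. \<lambda>c\<in>Obj C. \<lambda>z\<in>FObj (FObj (N \<circ>\<^sub>F T) b) c.
      SOME v. \<exists>k u y. fact c b (hom_decode S D (FObj i c) (FObj T b) z) k u y \<and> v = val c b k u y)"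
    have \<beta>_val: "\<beta> b c (code c (FObj T b) x) = val c b k u y"
      if c: "c \<in> Obj C" and b: "b \<in> Obj B" and x: "x \<in> Hom D (FObj i c) (FObj T b)"
        and f: "fact c b x k u y" for c b x k u y
    proof -
      have "\<beta> b c (code c (FObj T b) x) = (SOME v. \<exists>k u y. fact c b x k u y \<and> v = val c b k u y)"
        using c b x by (simp add: \<beta>_def nerve_FObj decode_code TO)
      also have "\<dots> = val c b k u y"
        by (rule some_equality) (use f val_unique[OF c b x] in blast)+
      finally show ?thesis .
    qed
    have fact_Hom: "x \<in> Hom D (FObj i c) (FObj T b)" if "fact c b x k u y" "c \<in> Obj C" "b \<in> Obj B" for c b x k u y
      using that by (auto simp: fact_def intro!: category_Comp[OF D] i_Obj TO KO functor_Arr[OF T])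
    have obtain_fact: "\<exists>x k u y. z = code c (FObj T b) x \<and> x \<in> Hom D (FObj i c) (FObj T b) \<and> fact c b x k u y"
      if "c \<in> Obj C" "b \<in> Obj B" "z \<in> FObj (FObj (N \<circ>\<^sub>F T) b) c" for c b z
      using that ex_fact by (auto simp: nerve_FObj)
    have \<beta>: "nat_trans B ?P (N \<circ>\<^sub>F T) H \<beta>"
    proof (rule presheaf_nat_transI[OF NT H])
      show "\<beta> \<in> extensional (Obj B)" "\<And>b. b \<in> Obj B \<Longrightarrow> \<beta> b \<in> extensional (Obj C)"
        by (simp_all add: \<beta>_def)
    next
      fix b c assume b: "b \<in> Obj B" and c: "c \<in> Obj C"
      have "\<beta> b c \<in> extensional (FObj (FObj (N \<circ>\<^sub>F T) b) c)" using b c by (simp add: \<beta>_def)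
      moreover have "\<beta> b c z \<in> FObj (FObj H b) c" if z: "z \<in> FObj (FObj (N \<circ>\<^sub>F T) b) c" for z
        using obtain_fact[OF c b z] \<beta>_val[OF c b] val_in[OF c b] by auto
      ultimately show "\<beta> b c \<in> FObj (FObj (N \<circ>\<^sub>F T) b) c \<rightarrow>\<^sub>E FObj (FObj H b) c" by (auto simp: PiE_iff)
    next
      fix b c c' f z assume b: "b \<in> Obj B" and c: "c \<in> Obj C" "c' \<in> Obj C" "f \<in> Hom C c' c"
        and z: "z \<in> FObj (FObj (N \<circ>\<^sub>F T) b) c"
      obtain x k u y where x: "z = code c (FObj T b) x" "x \<in> Hom D (FObj i c) (FObj T b)" "fact c b x k u y"
        using obtain_fact[OF c(1) b z] by blast
      \<comment> \<open>Naturality in the stage: precomposition with \<open>f\<close> leaves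
        \<open>u\<close> alone and is absorbed into \<open>y\<close>.\<close>
      let ?xf = "Comp D (FObj i c') (FObj i c) (FObj T b) x (FArr i c' c f)"
      let ?yf = "Comp D (FObj i c') (FObj i c) (FObj T (FObj K k)) y (FArr i c' c f)"
      have k: "k \<in> Obj C'" "u \<in> Hom B (FObj K k) b" "y \<in> Hom D (FObj i c) (FObj T (FObj K k))"
        "x = Comp D (FObj i c) (FObj T (FObj K k)) (FObj T b) (FArr T (FObj K k) b u) y"
        using x(3) by (auto simp: fact_def)
      note Kk = KO[OF k(1)]
      have fact': "fact c' b ?xf k u ?yf"
        unfolding fact_def
        using k Comp_i_in[OF c TO[OF Kk] k(3)] category_assoc[OF D i_Obj[OF c(2)] i_Obj[OF c(1)]
          TO[OF Kk] TO[OF b] i_Arr[OF c(2,1,3)] k(3) functor_Arr[OF T Kk b k(2)]] by simp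
      have "\<beta> b c' (FArr (FObj (N \<circ>\<^sub>F T) b) c c' f z) = \<beta> b c' (code c' (FObj T b) ?xf)"
        using x nerve_obj_FArr[OF c TO[OF b] x(2)] by simp
      also have "\<dots> = val c' b k u ?yf"
        by (rule \<beta>_val[OF c(2) b Comp_i_in[OF c TO[OF b] x(2)] fact'])
      also have "\<dots> = FArr H (FObj K k) b u c' (\<alpha> k c'
          (FArr (FObj N (FObj T (FObj K k))) c c' f (code c (FObj T (FObj K k)) y)))"
        by (simp add: val_def nerve_obj_FArr[OF c TO[OF Kk] k(3)])
      also have "\<dots> = FArr H (FObj K k) b u c' (FArr (FObj H (FObj K k)) c c' f
          (\<alpha> k c (code c (FObj T (FObj K k)) y)))"
        using presheaf_morphism_natural[OF _ c, of S "FObj N (FObj T (FObj K k))" "FObj H (FObj K k)" "\<alpha> k"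
            "code c (FObj T (FObj K k)) y"] nat_trans_in[OF \<alpha> k(1)] k c
        by (simp add: presheaf_cat_def nerve_FObj)
      also have "\<dots> = FArr (FObj H b) c c' f (val c b k u y)"
        using presheaf_morphism_natural[OF _ c \<alpha>_in[OF k(1) c(1) k(3)], of S "FObj H b" "FArr H (FObj K k) b u"]
          functor_Arr[OF H Kk b k(2)] by (simp add: presheaf_cat_def val_def)
      also have "\<dots> = FArr (FObj H b) c c' f (\<beta> b c z)"
        using \<beta>_val[OF c(1) b x(2,3)] x(1) by simp
      finally show "\<beta> b c' (FArr (FObj (N \<circ>\<^sub>F T) b) c c' f z) = FArr (FObj H b) c c' f (\<beta> b c z)" .
    next
      fix a b g c z assume a: "a \<in> Obj B" "b \<in> Obj B" "g \<in> Hom B a b" and c: "c \<in> Obj C"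
        and z: "z \<in> FObj (FObj (N \<circ>\<^sub>F T) a) c"
      obtain x k u y where x: "z = code c (FObj T a) x" "x \<in> Hom D (FObj i c) (FObj T a)" "fact c a x k u y"
        using obtain_fact[OF c a(1) z] by blast
      have k: "k \<in> Obj C'" "u \<in> Hom B (FObj K k) a" "y \<in> Hom D (FObj i c) (FObj T (FObj K k))"
        "x = Comp D (FObj i c) (FObj T (FObj K k)) (FObj T a) (FArr T (FObj K k) a u) y"
        using x(3) by (auto simp: fact_def)
      note Kk = KO[OF k(1)]
      let ?gx = "Comp D (FObj i c) (FObj T a) (FObj T b) (FArr T a b g) x"
      \<comment> \<open>Naturality in the base is dual: \<open>g\<close> is absorbed into
        \<open>u\<close>, and \<open>y\<close> stays.\<close>
      let ?gu = "Comp B (FObj K k) a b g u"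
      have fact': "fact c b ?gx k ?gu y"
        unfolding fact_def
        using k category_Comp[OF B Kk a(1,2) k(2) a(3)] functor_Comp[OF T Kk a(1,2) k(2) a(3)]
          category_assoc[OF D i_Obj[OF c] TO[OF Kk] TO[OF a(1)] TO[OF a(2)] k(3) functor_Arr[OF T Kk a(1) k(2)]
            functor_Arr[OF T a]] by simp
      have "\<beta> b c (FArr (N \<circ>\<^sub>F T) a b g c z) = \<beta> b c (code c (FObj T b) ?gx)"
        using x nerve_FArr[OF c TO[OF a(1)] x(2)] by simp
      also have "\<dots> = val c b k ?gu y"
        by (rule \<beta>_val[OF c a(2) fact_Hom[OF fact' c a(2)] fact'])
      also have "\<dots> = FArr H a b g c (val c a k u y)"
        unfolding val_def by (rule presheaf_functor_Comp[OF H Kk a(1,2) k(2) a(3) c \<alpha>_in[OF k(1) c k(3)]])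
      also have "\<dots> = FArr H a b g c (\<beta> a c z)"
        using \<beta>_val[OF c a(1) x(2,3)] x(1) by simp
      finally show "\<beta> b c (FArr (N \<circ>\<^sub>F T) a b g c z) = FArr H a b g c (\<beta> a c z)" .
    qed
    have \<alpha>_ext: "\<gamma> (FObj K k) = \<alpha> k"
      if \<gamma>: "nat_trans B ?P (N \<circ>\<^sub>F T) H \<gamma>" and k: "k \<in> Obj C'"
        and eq: "\<And>c y. c \<in> Obj C \<Longrightarrow> y \<in> Hom D (FObj i c) (FObj T (FObj K k)) \<Longrightarrow>
          \<gamma> (FObj K k) c (code c (FObj T (FObj K k)) y) = \<alpha> k c (code c (FObj T (FObj K k)) y)" for \<gamma> k
    proof (rule extensionalityI[OF presheaf_nat_trans_extensional(2)[OF \<gamma> KO[OF k]]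
            presheaf_nat_trans_extensional(2)[OF \<alpha> k]])
      fix c assume c: "c \<in> Obj C"
      show "\<gamma> (FObj K k) c = \<alpha> k c"
      proof (rule extensionalityI[OF presheaf_nat_trans_extensional(3)[OF \<gamma> KO[OF k] c]])
        show "\<alpha> k c \<in> extensional (FObj (FObj (N \<circ>\<^sub>F T) (FObj K k)) c)"
          using presheaf_nat_trans_extensional(3)[OF \<alpha> k c] by simp
      qed (use eq c in \<open>auto simp: nerve_FObj\<close>)
    qed
    have "\<exists>!\<beta>. nat_trans B ?P (N \<circ>\<^sub>F T) H \<beta> \<and> (\<forall>a\<in>Obj C'. \<beta> (FObj K a) = \<alpha> a)"
    proof (rule ex1I[of _ \<beta>], intro conjI ballI \<beta>)
      fix k assume k: "k \<in> Obj C'"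
      show "\<beta> (FObj K k) = \<alpha> k"
      proof (rule \<alpha>_ext[OF \<beta> k])
        fix c y assume c: "c \<in> Obj C" and y: "y \<in> Hom D (FObj i c) (FObj T (FObj K k))"
        \<comment> \<open>On the image of \<open>K\<close>, the trivial factorization through an
          identity reads off \<alpha> itself.\<close>
        have "fact c (FObj K k) y k (Ident B (FObj K k)) y"
          using k y c by (simp add: fact_def category_Ident[OF B] KO TO functor_Ident[OF T]
              category_Ident_Comp[OF D] i_Obj)
        from \<beta>_val[OF c KO[OF k] y this]
        show "\<beta> (FObj K k) c (code c (FObj T (FObj K k)) y) = \<alpha> k c (code c (FObj T (FObj K k)) y)"
          using presheaf_functor_Ident[OF H KO[OF k] c \<alpha>_in[OF k c y]] by (simp add: val_def)
      qed
    next
      fix \<gamma> assume "nat_trans B ?P (N \<circ>\<^sub>F T) H \<gamma> \<and> (\<forall>a\<in>Obj C'. \<gamma> (FObj K a) = \<alpha> a)"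
      then have \<gamma>: "nat_trans B ?P (N \<circ>\<^sub>F T) H \<gamma>" "\<And>a. a \<in> Obj C' \<Longrightarrow> \<gamma> (FObj K a) = \<alpha> a" by auto
      show "\<gamma> = \<beta>"
      proof (rule presheaf_nat_trans_eqI[OF \<gamma>(1) \<beta>])
        fix b c z assume b: "b \<in> Obj B" and c: "c \<in> Obj C" and z: "z \<in> FObj (FObj (N \<circ>\<^sub>F T) b) c"
        obtain x k u y where x: "z = code c (FObj T b) x" "x \<in> Hom D (FObj i c) (FObj T b)" "fact c b x k u y"
          using obtain_fact[OF c b z] by blast
        then have k: "k \<in> Obj C'" "u \<in> Hom B (FObj K k) b" "y \<in> Hom D (FObj i c) (FObj T (FObj K k))"
          "x = Comp D (FObj i c) (FObj T (FObj K k)) (FObj T b) (FArr T (FObj K k) b u) y"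
          by (auto simp: fact_def)
        \<comment> \<open>Every element over \<open>b\<close> is the image under \<open>u\<close> of
          an element over \<open>FObj K k\<close>, where \<gamma> is prescribed; naturality in
          \<open>u\<close> then leaves no choice.\<close>
        have "z = FArr (N \<circ>\<^sub>F T) (FObj K k) b u c (code c (FObj T (FObj K k)) y)"
          using nerve_FArr[OF c TO[OF KO[OF k(1)]] k(3)] x(1) k(4) by simp
        then have "\<gamma> b c z = FArr H (FObj K k) b u c (\<gamma> (FObj K k) c (code c (FObj T (FObj K k)) y))"
          using presheaf_nat_trans_natural[OF \<gamma>(1) KO[OF k(1)] b k(2) c, of "code c (FObj T (FObj K k)) y"]
            k c by (simp add: nerve_FObj)
        also have "\<dots> = \<beta> b c z"
          using \<beta>_val[OF c b x(2,3)] x(1) \<gamma>(2)[OF k(1)] by (simp add: val_def)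
        finally show "\<gamma> b c z = \<beta> b c z" .
      qed
    qed
    then show ?thesis using unit by (metis (no_types, lifting))
  qed
  moreover have "nat_trans C' ?P (N \<circ>\<^sub>F T \<circ>\<^sub>F K) ((N \<circ>\<^sub>F T) \<circ>\<^sub>F K) (id_trans C' ?P (N \<circ>\<^sub>F T \<circ>\<^sub>F K))"
    using nat_trans_id_trans[OF NTK] by (simp add: comp_functor_assoc)
  ultimately show ?thesis
    unfolding is_left_kan_extension_def using K NTK NT by blast
qed

end

section \<open>Small sets\<close>

lemma universe_subset: "universe S \<Longrightarrow> X \<in> S \<Longrightarrow> Y \<subseteq> X \<Longrightarrow> Y \<in> S"
  by (simp add: universe_def)

lemma universe_image: "universe S \<Longrightarrow> X \<in> S \<Longrightarrow> f ` X \<in> S"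
  by (simp add: universe_def)

lemma universe_UN: "universe S \<Longrightarrow> X \<in> S \<Longrightarrow> (\<And>x. x \<in> X \<Longrightarrow> F x \<in> S) \<Longrightarrow> (\<Union>x\<in>X. F x) \<in> S"
  by (simp add: universe_def)

text \<open>An infinite member of \<open>S\<close> contains a copy of the natural numbers, and
  closure under images carries that copy to any countable family.\<close>

lemma universe_range_nat:
  assumes S: "universe (S :: 'u set set)"
  shows "range (f :: nat \<Rightarrow> 'u) \<in> S"
proof -
  have "\<exists>X\<in>S. infinite X" using S unfolding universe_def by (rule conjunct1)
  then obtain X where X: "X \<in> S" "infinite X" by blast
  obtain c :: "nat \<Rightarrow> 'u" where c: "inj c" "range c \<subseteq> X" using infinite_countable_subset[OF X(2)] by blast
  have "(f \<circ> inv c) ` range c \<in> S" by (rule universe_image[OF S universe_subset[OF S X(1) c(2)]])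
  moreover have "(f \<circ> inv c) ` range c = range f"
    using c(1) by (simp add: image_image)
  ultimately show ?thesis by simp
qed

text \<open>Small unions are indexed by members of \<open>S\<close>, so the index \<open>n\<close>
  is replaced by its code; the set of codes is in \<open>S\<close> by the previous lemma.\<close>

lemma universe_UN_nat:
  assumes S: "universe (S :: 'u set set)" and F: "\<And>n :: nat. F n \<in> S"
  shows "(\<Union>n. F n) \<in> S"
proof -
  note inj = inj_nat_code[OF universe_infinite_type[OF S]]
  have "(\<Union>x\<in>range (nat_code :: nat \<Rightarrow> 'u). F (inv nat_code x)) \<in> S"
    by (rule universe_UN[OF S universe_range_nat[OF S]]) (rule F)
  then show ?thesis using inj by simp
qed

lemma small_set_inj_nat:
  assumes S: "universe (S :: 'u set set)" and f: "inj_on (f :: 'x \<Rightarrow> nat) X"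
  shows "small_set S X"
proof -
  have "inj_on ((nat_code :: nat \<Rightarrow> 'u) \<circ> f) X"
    by (rule comp_inj_on[OF f inj_on_subset[OF inj_nat_code[OF universe_infinite_type[OF S]]]]) simp
  moreover have "(nat_code \<circ> f) ` X \<in> S"
    by (rule universe_subset[OF S universe_range_nat[OF S, of nat_code]]) auto
  ultimately show ?thesis unfolding small_set_def by blast
qed

section \<open>Graphs and paths\<close>

lemma graph_Obj_iff:
  "G \<in> Obj (graph_cat S) \<longleftrightarrow> Verts G \<in> S \<and> Edges G \<in> S \<and>
     Src G \<in> Edges G \<rightarrow>\<^sub>E Verts G \<and> Tgt G \<in> Edges G \<rightarrow>\<^sub>E Verts G"
  by (simp add: graph_cat_def)

lemma graph_Hom_iff:
  "h \<in> Hom (graph_cat S) G H \<longleftrightarrow> fst h \<in> Verts G \<rightarrow>\<^sub>E Verts H \<and> snd h \<in> Edges G \<rightarrow>\<^sub>E Edges H \<and>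
     (\<forall>e\<in>Edges G. Src H (snd h e) = fst h (Src G e) \<and> Tgt H (snd h e) = fst h (Tgt G e))"
  by (auto simp: graph_cat_def)

lemma graph_Ident [simp]: "Ident (graph_cat S) G = (\<lambda>v\<in>Verts G. v, \<lambda>e\<in>Edges G. e)"
  by (simp add: graph_cat_def)

lemma graph_Comp_apply [simp]:
  "v \<in> Verts G \<Longrightarrow> fst (Comp (graph_cat S) G H K p q) v = fst p (fst q v)"
  "e \<in> Edges G \<Longrightarrow> snd (Comp (graph_cat S) G H K p q) e = snd p (snd q e)"
  by (simp_all add: graph_cat_def compose_def)

lemma graph_src_tgt:
  "G \<in> Obj (graph_cat S) \<Longrightarrow> e \<in> Edges G \<Longrightarrow> Src G e \<in> Verts G"
  "G \<in> Obj (graph_cat S) \<Longrightarrow> e \<in> Edges G \<Longrightarrow> Tgt G e \<in> Verts G"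
  by (auto simp: graph_Obj_iff PiE_iff)

lemma graph_Hom_apply:
  assumes "h \<in> Hom (graph_cat S) G H"
  shows "v \<in> Verts G \<Longrightarrow> fst h v \<in> Verts H" "e \<in> Edges G \<Longrightarrow> snd h e \<in> Edges H"
    "e \<in> Edges G \<Longrightarrow> Src H (snd h e) = fst h (Src G e)"
    "e \<in> Edges G \<Longrightarrow> Tgt H (snd h e) = fst h (Tgt G e)"
  using assms by (auto simp: graph_Hom_iff PiE_iff)

lemma graph_Hom_eqI:
  assumes "p \<in> Hom (graph_cat S) G H" "q \<in> Hom (graph_cat S) G H"
    and "\<And>v. v \<in> Verts G \<Longrightarrow> fst p v = fst q v" "\<And>e. e \<in> Edges G \<Longrightarrow> snd p e = snd q e"
  shows "p = q"
  using assms by (auto simp: graph_Hom_iff PiE_iff intro!: prod_eqI intro: extensionalityI)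

lemma graph_Comp_in:
  assumes G: "G \<in> Obj (graph_cat S)" and q: "q \<in> Hom (graph_cat S) G H" and p: "p \<in> Hom (graph_cat S) H K"
  shows "Comp (graph_cat S) G H K p q \<in> Hom (graph_cat S) G K"
proof -
  have "fst (Comp (graph_cat S) G H K p q) \<in> extensional (Verts G)"
    "snd (Comp (graph_cat S) G H K p q) \<in> extensional (Edges G)"
    by (simp_all add: graph_cat_def)
  then show ?thesis
    using graph_Hom_apply[OF p] graph_Hom_apply[OF q] graph_src_tgt[OF G]
    by (auto simp: graph_Hom_iff PiE_iff)
qed

lemma category_graph_cat: "category (graph_cat S)"
  unfolding category_def
proof (intro conjI ballI graph_Comp_in)
  fix G assume G: "G \<in> Obj (graph_cat S)"
  then show id: "Ident (graph_cat S) G \<in> Hom (graph_cat S) G G"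
    using graph_src_tgt[OF G] by (auto simp: graph_Hom_iff)
next
  fix G H h assume G: "G \<in> Obj (graph_cat S)" and H: "H \<in> Obj (graph_cat S)" and h: "h \<in> Hom (graph_cat S) G H"
  have id: "Ident (graph_cat S) X \<in> Hom (graph_cat S) X X" if "X \<in> Obj (graph_cat S)" for X
    using graph_src_tgt[OF that] by (auto simp: graph_Hom_iff)
  show "Comp (graph_cat S) G G H h (Ident (graph_cat S) G) = h"
    by (rule graph_Hom_eqI[OF graph_Comp_in[OF G id[OF G] h] h]) auto
  show "Comp (graph_cat S) G H H (Ident (graph_cat S) H) h = h"
    by (rule graph_Hom_eqI[OF graph_Comp_in[OF G h id[OF H]] h]) (auto simp: graph_Hom_apply[OF h])
next
  fix G H K L f g h assume G: "G \<in> Obj (graph_cat S)" "H \<in> Obj (graph_cat S)"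
    and h: "f \<in> Hom (graph_cat S) G H" "g \<in> Hom (graph_cat S) H K" "h \<in> Hom (graph_cat S) K L"
  show "Comp (graph_cat S) G K L h (Comp (graph_cat S) G H K g f) =
      Comp (graph_cat S) G H L (Comp (graph_cat S) H K L h g) f"
    by (rule graph_Hom_eqI[OF graph_Comp_in[OF G(1) graph_Comp_in[OF G(1) h(1,2)] h(3)]
        graph_Comp_in[OF G(1) h(1) graph_Comp_in[OF G(2) h(2,3)]]]) (auto simp: graph_Hom_apply[OF h(1)])
qed auto

lemma is_path_start: "G \<in> Obj (graph_cat S) \<Longrightarrow> is_path G v es \<Longrightarrow> v \<in> Verts G"
  by (cases es) (auto simp: graph_src_tgt)

lemma is_path_edges: "is_path G v es \<Longrightarrow> set es \<subseteq> Edges G"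
  by (induction es arbitrary: v) auto

lemma path_end_in: "is_path G v es \<Longrightarrow> path_end G v es \<in> Verts G"
  by (induction es arbitrary: v) auto

lemma path_end_append [simp]: "path_end G v (xs @ ys) = path_end G (path_end G v xs) ys"
  by (induction xs arbitrary: v) auto

text \<open>That \<open>G\<close> is a graph object matters for the empty prefix: the left side must
  then yield that \<open>v\<close> is a vertex, which \<open>is_path_start\<close> extracts from
  \<open>ys\<close>.\<close>

lemma is_path_append:
  "G \<in> Obj (graph_cat S) \<Longrightarrow> is_path G v (xs @ ys) \<longleftrightarrow> is_path G v xs \<and> is_path G (path_end G v xs) ys"
  by (induction xs arbitrary: v) (auto dest: is_path_start)

lemma is_path_map:
  assumes h: "h \<in> Hom (graph_cat S) G H"
  shows "is_path G v es \<Longrightarrow> is_path H (fst h v) (map (snd h) es)"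
  by (induction es arbitrary: v) (auto simp: graph_Hom_apply[OF h])

lemma path_end_map:
  assumes h: "h \<in> Hom (graph_cat S) G H"
  shows "is_path G v es \<Longrightarrow> path_end H (fst h v) (map (snd h) es) = fst h (path_end G v es)"
  by (induction es arbitrary: v) (auto simp: graph_Hom_apply[OF h])

section \<open>The free category monad\<close>

locale graph_universe =
  fixes S :: "'u set set"
  assumes S: "universe S"
begin

abbreviation \<G> where "\<G> \<equiv> graph_cat S"
abbreviation T :: "('u mgraph, ('u \<Rightarrow> 'u) \<times> ('u \<Rightarrow> 'u), 'u mgraph, ('u \<Rightarrow> 'u) \<times> ('u \<Rightarrow> 'u)) ftor"
  where "T \<equiv> free_functor"

lemma path_decode_code [simp]: "path_decode (path_code p :: 'u) = p"
  unfolding path_decode_def by (rule inv_f_f[OF inj_path_code[OF universe_infinite_type[OF S]]])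

lemma free_graph_Verts [simp]: "Verts (free_graph G) = Verts G"
  by (simp add: free_graph_def Let_def)

lemma free_graph_Edges: "Edges (free_graph G) = path_code ` {(v, es). is_path G v es}"
  by (simp add: free_graph_def Let_def)

lemma free_graph_EdgesE:
  assumes "p \<in> Edges (free_graph G)"
  obtains v es where "p = path_code (v, es)" "is_path G v es"
  using assms by (auto simp: free_graph_Edges)

lemma free_graph_EdgesI [intro, simp]: "is_path G v es \<Longrightarrow> path_code (v, es) \<in> Edges (free_graph G)"
  by (auto simp: free_graph_Edges)

lemma free_graph_Src_Tgt [simp]:
  assumes "is_path G v (es :: 'u list)"
  shows "Src (free_graph G) (path_code (v, es)) = v"
    "Tgt (free_graph G) (path_code (v, es)) = path_end G v es"
  using assms by (auto simp: free_graph_def Let_def)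

text \<open>Stratify by length. Paths of length \<open>n + 1\<close> lie in a union, indexed by the
  first edge, of images of the paths of length \<open>n\<close>, and one countable union collects
  all lengths. This stays within the closure properties of \<open>S\<close>, which do not include
  power sets.\<close>

lemma free_graph_Edges_in:
  assumes G: "G \<in> Obj \<G>"
  shows "Edges (free_graph G) \<in> S"
proof -
  define P where "P n = path_code ` {(v, es). is_path G v es \<and> length es = n}" for n
  have V: "Verts G \<in> S" and E: "Edges G \<in> S" using G by (auto simp: graph_Obj_iff)
  have "P n \<in> S" for n
  proof (induction n)
    case 0
    have "P 0 = (\<lambda>v. path_code (v, [])) ` Verts G" by (auto simp: P_def)
    then show ?case by (simp only: universe_image[OF S V])
  next
    case (Suc n)
    \<comment> \<open>Only an inclusion: prepending \<open>e\<close> to every member of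
      \<open>P n\<close> also produces lists that are not composable.\<close>
    have "P (Suc n) \<subseteq> (\<Union>e\<in>Edges G. (\<lambda>p. path_code (Src G e, e # snd (path_decode p))) ` P n)"
    proof
      fix p assume "p \<in> P (Suc n)"
      then obtain v es where p: "p = path_code (v, es)" "is_path G v es" "length es = Suc n"
        by (auto simp: P_def)
      then obtain e es' where es: "es = e # es'" by (cases es) auto
      have "path_code (Tgt G e, es') \<in> P n" using p es by (auto simp: P_def)
      then have "path_code (Src G e, e # snd (path_decode (path_code (Tgt G e, es') :: 'u)))
          \<in> (\<lambda>p. path_code (Src G e, e # snd (path_decode p))) ` P n" by (rule imageI)
      then show "p \<in> (\<Union>e\<in>Edges G. (\<lambda>p. path_code (Src G e, e # snd (path_decode p))) ` P n)"
        using p es by (intro UN_I[of e]) simp_all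
    qed
    moreover have "(\<Union>e\<in>Edges G. (\<lambda>p. path_code (Src G e, e # snd (path_decode p))) ` P n) \<in> S"
      by (rule universe_UN[OF S E], rule universe_image[OF S Suc])
    ultimately show ?case by (rule universe_subset[OF S, rotated])
  qed
  moreover have "Edges (free_graph G) = (\<Union>n. P n)" by (auto simp: free_graph_Edges P_def)
  ultimately show ?thesis by (simp only: universe_UN_nat[OF S])
qed

lemma free_graph_Obj:
  assumes G: "G \<in> Obj \<G>"
  shows "free_graph G \<in> Obj \<G>"
proof -
  have "Src (free_graph G) \<in> extensional (Edges (free_graph G))"
    "Tgt (free_graph G) \<in> extensional (Edges (free_graph G))"
    by (simp_all add: free_graph_def Let_def)
  then show ?thesis
    using G free_graph_Edges_in[OF G]
    by (auto simp: graph_Obj_iff PiE_iff is_path_start[OF G] path_end_in elim!: free_graph_EdgesE)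
qed

lemma free_functor_simps [simp]:
  "FObj free_functor = free_graph" "fst (FArr T G H h) = fst h"
  "is_path G v es \<Longrightarrow> snd (FArr T G H h) (path_code (v, es)) = path_code (fst h v, map (snd h) es)"
  by (auto simp: free_functor_def split: prod.splits)

lemma free_functor_Arr:
  assumes G: "G \<in> Obj \<G>" and h: "h \<in> Hom \<G> G H"
  shows "FArr T G H h \<in> Hom \<G> (free_graph G) (free_graph H)"
proof -
  have "fst h \<in> extensional (Verts G)" using h by (auto simp: graph_Hom_iff PiE_iff)
  moreover have "snd (FArr T G H h) \<in> extensional (Edges (free_graph G))"
    by (simp add: free_functor_def split: prod.splits)
  ultimately show ?thesis
    using graph_Hom_apply[OF h] is_path_map[OF h] path_end_map[OF h]
    by (auto simp: graph_Hom_iff PiE_iff elim!: free_graph_EdgesE)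
qed

lemma free_functor_functor: "is_functor \<G> \<G> T"
  unfolding is_functor_def
proof (intro conjI ballI category_graph_cat)
  fix G assume "G \<in> Obj \<G>"
  then show "FObj T G \<in> Obj \<G>" by (simp add: free_graph_Obj)
next
  fix G H h assume "G \<in> Obj \<G>" "h \<in> Hom \<G> G H"
  then show "FArr T G H h \<in> Hom \<G> (FObj T G) (FObj T H)" by (simp add: free_functor_Arr)
next
  fix G assume G: "G \<in> Obj \<G>"
  have "map (\<lambda>e\<in>Edges G. e) es = es" if "is_path G v es" for v es
    using is_path_edges[OF that] by (intro map_idI) auto
  then show "FArr T G G (Ident \<G> G) = Ident \<G> (FObj T G)"
    using free_functor_Arr[OF G category_Ident[OF category_graph_cat G]]
      category_Ident[OF category_graph_cat free_graph_Obj[OF G]]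
    by (intro graph_Hom_eqI[of _ S "free_graph G" "free_graph G"])
      (auto elim!: free_graph_EdgesE simp: is_path_start[OF G])
next
  fix G H K f g assume G: "G \<in> Obj \<G>" "H \<in> Obj \<G>" "K \<in> Obj \<G>" and f: "f \<in> Hom \<G> G H" and g: "g \<in> Hom \<G> H K"
  have eq: "map (snd (Comp \<G> G H K g f)) es = map (snd g) (map (snd f) es)" if "is_path G v es" for v es
    using is_path_edges[OF that] by auto
  show "FArr T G K (Comp \<G> G H K g f) =
      Comp \<G> (FObj T G) (FObj T H) (FObj T K) (FArr T H K g) (FArr T G H f)"
    using G free_functor_Arr[OF G(1) graph_Comp_in[OF G(1) f g]]
      graph_Comp_in[OF free_graph_Obj[OF G(1)] free_functor_Arr[OF G(1) f] free_functor_Arr[OF G(2) g]]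
      is_path_map[OF f]
    by (intro graph_Hom_eqI[of _ S "free_graph G" "free_graph K"])
      (auto elim!: free_graph_EdgesE simp: is_path_start[OF G(1)] eq simp del: map_map)
qed

section \<open>Unit, multiplication and the monad laws\<close>

text \<open>The multiplication stripped of the outer coding, so that naturality and the monad laws
  become inductions on lists.\<close>

definition flatten :: "'u list \<Rightarrow> 'u list" where
  "flatten ps = concat (map (\<lambda>q. snd (path_decode q)) ps)"

lemma flatten_simps [simp]:
  "flatten [] = []" "flatten (p # ps) = snd (path_decode p) @ flatten ps"
  by (simp_all add: flatten_def)

lemma is_path_flatten:
  assumes G: "G \<in> Obj \<G>"
  shows "is_path (free_graph G) v ps \<Longrightarrow> is_path G v (flatten ps)"
    "is_path (free_graph G) v ps \<Longrightarrow> path_end G v (flatten ps) = path_end (free_graph G) v ps"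
  by (induction ps arbitrary: v) (auto simp: is_path_append[OF G] elim!: free_graph_EdgesE)

lemma flatten_map:
  assumes G: "G \<in> Obj \<G>" and h: "h \<in> Hom \<G> G H"
  shows "is_path (free_graph G) v ps \<Longrightarrow> flatten (map (snd (FArr T G H h)) ps) = map (snd h) (flatten ps)"
  by (induction ps arbitrary: v) (auto elim!: free_graph_EdgesE)

lemma free_unit_simps [simp]:
  assumes "G \<in> Obj \<G>"
  shows "fst (free_unit S G) = (\<lambda>v\<in>Verts G. v)"
    "snd (free_unit S G) = (\<lambda>e\<in>Edges G. path_code (Src G e, [e]))"
  using assms by (simp_all add: free_unit_def)

lemma free_mult_fst [simp]: "G \<in> Obj \<G> \<Longrightarrow> fst (free_mult S G) = (\<lambda>v\<in>Verts G. v)"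
  by (simp add: free_mult_def)

lemma free_mult_snd [simp]:
  assumes "G \<in> Obj \<G>" "is_path (free_graph G) v ps"
  shows "snd (free_mult S G) (path_code (v, ps)) = path_code (v, flatten ps)"
  using assms by (simp add: free_mult_def flatten_def)

lemma free_unit_in:
  assumes G: "G \<in> Obj \<G>"
  shows "free_unit S G \<in> Hom \<G> G (free_graph G)"
  using G by (auto simp: graph_Hom_iff graph_src_tgt[OF G])

lemma free_mult_in:
  assumes G: "G \<in> Obj \<G>"
  shows "free_mult S G \<in> Hom \<G> (free_graph (free_graph G)) (free_graph G)"
proof -
  have "snd (free_mult S G) \<in> extensional (Edges (free_graph (free_graph G)))"
    using G by (simp add: free_mult_def)
  then show ?thesis
    using G is_path_start[OF free_graph_Obj[OF G]] path_end_in[of "free_graph G"]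
    by (auto simp: graph_Hom_iff PiE_iff is_path_flatten[OF G] elim!: free_graph_EdgesE)
qed

lemma free_unit_nat_trans: "nat_trans \<G> \<G> id_functor T (free_unit S)"
  unfolding nat_trans_def
proof (intro conjI ballI id_functor_functor category_graph_cat free_functor_functor)
  show "free_unit S \<in> (\<Pi>\<^sub>E a\<in>Obj \<G>. Hom \<G> (FObj id_functor a) (FObj T a))"
    using free_unit_in by (auto simp: PiE_iff) (simp add: free_unit_def)
  fix G H h assume G: "G \<in> Obj \<G>" and H: "H \<in> Obj \<G>" and h: "h \<in> Hom \<G> G H"
  have "is_path G (Src G e) [e]" if "e \<in> Edges G" for e using that graph_src_tgt[OF G] by simp
  then have "Comp \<G> G H (free_graph H) (free_unit S H) h =
      Comp \<G> G (free_graph G) (free_graph H) (FArr T G H h) (free_unit S G)"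
    using G H graph_Hom_apply[OF h]
    by (intro graph_Hom_eqI[OF graph_Comp_in[OF G h free_unit_in[OF H]]
        graph_Comp_in[OF G free_unit_in[OF G] free_functor_Arr[OF G h]]])
      (auto simp del: is_path.simps)
  then show "Comp \<G> (FObj id_functor G) (FObj id_functor H) (FObj T H) (free_unit S H) (FArr id_functor G H h) =
      Comp \<G> (FObj id_functor G) (FObj T G) (FObj T H) (FArr T G H h) (free_unit S G)"
    by simp
qed

lemma free_mult_nat_trans: "nat_trans \<G> \<G> (T \<circ>\<^sub>F T) T (free_mult S)"
  unfolding nat_trans_def
proof (intro conjI ballI functor_comp_functor[OF free_functor_functor free_functor_functor] free_functor_functor)
  show "free_mult S \<in> (\<Pi>\<^sub>E a\<in>Obj \<G>. Hom \<G> (FObj (T \<circ>\<^sub>F T) a) (FObj T a))"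
    using free_mult_in by (auto simp: PiE_iff) (simp add: free_mult_def)
  fix G H h assume G: "G \<in> Obj \<G>" and H: "H \<in> Obj \<G>" and h: "h \<in> Hom \<G> G H"
  note TG = free_graph_Obj[OF G] and TH = free_graph_Obj[OF H] and Th = free_functor_Arr[OF G h]
  note TTh = free_functor_Arr[OF TG Th]
  have "Comp \<G> (free_graph (free_graph G)) (free_graph (free_graph H)) (free_graph H) (free_mult S H)
        (FArr T (free_graph G) (free_graph H) (FArr T G H h)) =
      Comp \<G> (free_graph (free_graph G)) (free_graph G) (free_graph H) (FArr T G H h) (free_mult S G)"
    using G H graph_Hom_apply[OF h] is_path_map[OF Th] is_path_start[OF TG]
    by (intro graph_Hom_eqI[OF graph_Comp_in[OF free_graph_Obj[OF TG] TTh free_mult_in[OF H]]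
        graph_Comp_in[OF free_graph_Obj[OF TG] free_mult_in[OF G] Th]])
      (auto elim!: free_graph_EdgesE simp: is_path_flatten flatten_map[OF G h])
  then show "Comp \<G> (FObj (T \<circ>\<^sub>F T) G) (FObj (T \<circ>\<^sub>F T) H) (FObj T H) (free_mult S H) (FArr (T \<circ>\<^sub>F T) G H h) =
      Comp \<G> (FObj (T \<circ>\<^sub>F T) G) (FObj T G) (FObj T H) (FArr T G H h) (free_mult S G)"
    by simp
qed

text \<open>Associativity of the multiplication, on lists. The path hypothesis ensures that each
  entry of \<open>qs\<close> codes a path of paths, which is where \<open>free_mult\<close> has a
  specified value.\<close>

lemma flatten_map_mult:
  assumes G: "G \<in> Obj \<G>"
  shows "is_path (free_graph (free_graph G)) v qs \<Longrightarrow>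
    flatten (map (snd (free_mult S G)) qs) = flatten (flatten qs)"
  by (induction qs arbitrary: v) (auto elim!: free_graph_EdgesE simp: G flatten_def)

text \<open>The unit law for \<open>T\<close> applied to the unit: each edge becomes a block of
  length one, and concatenating such blocks returns the list.\<close>

lemma flatten_map_unit:
  assumes G: "G \<in> Obj \<G>"
  shows "is_path G v es \<Longrightarrow> flatten (map (snd (free_unit S G)) es) = es"
  by (induction es arbitrary: v) (auto simp: G)

lemma free_monad: "is_monad \<G> T (free_unit S) (free_mult S)"
  unfolding is_monad_def Let_def
proof (intro conjI ballI free_functor_functor free_unit_nat_trans free_mult_nat_trans)
  fix G assume G: "G \<in> Obj \<G>"
  let ?T = free_graph
  note T1 = free_graph_Obj[OF G] note T2 = free_graph_Obj[OF T1] note T3 = free_graph_Obj[OF T2]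
  note \<mu> = free_mult_in[OF G] and \<mu>T = free_mult_in[OF T1] and \<eta> = free_unit_in[OF G] and \<eta>T = free_unit_in[OF T1]
  have T\<mu>: "FArr T (?T (?T G)) (?T G) (free_mult S G) \<in> Hom \<G> (?T (?T (?T G))) (?T (?T G))"
    by (rule free_functor_Arr[OF T2 \<mu>])
  have T\<eta>: "FArr T G (?T G) (free_unit S G) \<in> Hom \<G> (?T G) (?T (?T G))"
    by (rule free_functor_Arr[OF G \<eta>])
  have start: "is_path (?T (?T G)) v qs \<Longrightarrow> v \<in> Verts G" for v qs using is_path_start[OF T2] by auto
  have "Comp \<G> (?T (?T (?T G))) (?T (?T G)) (?T G) (free_mult S G) (FArr T (?T (?T G)) (?T G) (free_mult S G)) =
      Comp \<G> (?T (?T (?T G))) (?T (?T G)) (?T G) (free_mult S G) (free_mult S (?T G))"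
    using is_path_map[OF \<mu>] G T1 start is_path_flatten[OF T1]
    by (intro graph_Hom_eqI[OF graph_Comp_in[OF T3 T\<mu> \<mu>] graph_Comp_in[OF T3 \<mu>T \<mu>]])
      (auto elim!: free_graph_EdgesE simp: flatten_map_mult[OF G])
  then show "Comp \<G> (FObj T (FObj T (FObj T G))) (FObj T (FObj T G)) (FObj T G) (free_mult S G)
      (FArr T (FObj T (FObj T G)) (FObj T G) (free_mult S G)) =
    Comp \<G> (FObj T (FObj T (FObj T G))) (FObj T (FObj T G)) (FObj T G) (free_mult S G) (free_mult S (FObj T G))"
    by simp
  \<comment> \<open>For the other unit law: the unit at \<open>?T G\<close> wraps the edge coding
    \<open>es\<close> into a list of length one, whose flattening is \<open>es\<close>.\<close>
  have single: "is_path (?T G) v [path_code (v, es)]" if "is_path G v es" for v es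
    using that path_end_in[OF that] by simp
  have "Comp \<G> (?T G) (?T (?T G)) (?T G) (free_mult S G) (free_unit S (?T G)) = Ident \<G> (?T G)"
    using G T1 single
    by (intro graph_Hom_eqI[OF graph_Comp_in[OF T1 \<eta>T \<mu>] category_Ident[OF category_graph_cat T1]])
      (auto elim!: free_graph_EdgesE simp del: is_path.simps)
  then show "Comp \<G> (FObj T G) (FObj T (FObj T G)) (FObj T G) (free_mult S G) (free_unit S (FObj T G)) =
    Ident \<G> (FObj T G)" by simp
  have "Comp \<G> (?T G) (?T (?T G)) (?T G) (free_mult S G) (FArr T G (?T G) (free_unit S G)) = Ident \<G> (?T G)"
    using G T1 is_path_map[OF \<eta>] is_path_start[OF G]
    by (intro graph_Hom_eqI[OF graph_Comp_in[OF T1 T\<eta> \<mu>] category_Ident[OF category_graph_cat T1]])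
      (auto elim!: free_graph_EdgesE simp: flatten_map_unit[OF G, unfolded free_unit_simps[OF G]])
  then show "Comp \<G> (FObj T G) (FObj T (FObj T G)) (FObj T G) (free_mult S G)
      (FArr T G (FObj T G) (free_unit S G)) = Ident \<G> (FObj T G)" by simp
qed

end

section \<open>Linear graphs\<close>

text \<open>The sum of the first \<open>p\<close> lengths is the position where the first
  \<open>p\<close> blocks end. These positions become the vertices hit by
  \<open>subdivision\<close>.\<close>

lemma take_concat:
  assumes "p \<le> length xss"
  shows "take (sum_list (take p (map length xss))) (concat xss) = concat (take p xss)"
proof -
  have "concat xss = concat (take p xss @ drop p xss)" by simp
  also have "\<dots> = concat (take p xss) @ concat (drop p xss)" by (rule concat_append)
  finally show ?thesis by (simp add: length_concat take_map)
qed

lemma sum_list_take_le: "p \<le> q \<Longrightarrow> sum_list (take p ls) \<le> sum_list (take q (ls :: nat list))"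
proof -
  assume "p \<le> q"
  then have "take q ls = take p ls @ take (q - p) (drop p ls)"
    by (metis add_diff_inverse_nat not_less take_add)
  then show ?thesis by simp
qed

lemma sum_list_take_le_sum: "sum_list (take p ls) \<le> sum_list (ls :: nat list)"
  using sum_list_take_le[of p "max p (length ls)" ls] by simp

text \<open>Split the concatenation around block \<open>p\<close>: it occupies the positions between
  two consecutive partial sums. This is how a single path of the original sequence is recovered from
  the concatenated path.\<close>

lemma concat_segment:
  assumes p: "p < length xss"
  shows "map (\<lambda>q. concat xss ! q) [sum_list (take p (map length xss))..<sum_list (take (Suc p) (map length xss))] = xss ! p"
proof (rule nth_equalityI)
  have len: "sum_list (take (Suc p) (map length xss)) = sum_list (take p (map length xss)) + length (xss ! p)"
    using p by (simp add: take_Suc_conv_app_nth)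
  show "length (map (\<lambda>q. concat xss ! q) [sum_list (take p (map length xss))..<sum_list (take (Suc p) (map length xss))])
      = length (xss ! p)" using len by simp
  fix q assume "q < length (map (\<lambda>q. concat xss ! q) [sum_list (take p (map length xss))..<sum_list (take (Suc p) (map length xss))])"
  then have q: "q < length (xss ! p)" using len by simp
  have "concat xss = concat (take p xss @ xss ! p # drop (Suc p) xss)"
    by (simp only: id_take_nth_drop[OF p, symmetric])
  then have xss: "concat xss = concat (take p xss) @ (xss ! p) @ concat (drop (Suc p) xss)" by simp
  have "length (concat (take p xss)) = sum_list (take p (map length xss))"
    by (simp add: length_concat take_map)
  then have "concat xss ! (sum_list (take p (map length xss)) + q) = (xss ! p) ! q"
    using q by (subst xss) (simp add: nth_append)
  then show "map (\<lambda>q. concat xss ! q) [sum_list (take p (map length xss))..<sum_list (take (Suc p) (map length xss))] ! q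
      = xss ! p ! q"
    using q len by simp
qed

section \<open>The category of arities\<close>

lemma Delta0_simps [simp]:
  "Obj Delta0 = UNIV" "Ident Delta0 m = (\<lambda>p\<in>{0..m}. p)" "Comp Delta0 l m n g f = compose {0..l} g f"
  by (simp_all add: Delta0_def)

lemma Delta0_Hom: "f \<in> Hom Delta0 m n \<longleftrightarrow> f \<in> {0..m} \<rightarrow>\<^sub>E {0..n} \<and> (\<forall>p<m. f (Suc p) = Suc (f p))"
  by (simp add: Delta0_def)

text \<open>The strict bound comes from the successor condition: \<open>f p + 1\<close> is again a
  value of \<open>f\<close>, hence at most \<open>n\<close>. It is what sends edges of linear graphs
  to edges.\<close>

lemma Delta0_Hom_apply:
  assumes f: "f \<in> Hom Delta0 m n"
  shows "p \<le> m \<Longrightarrow> f p \<le> n" "p < m \<Longrightarrow> f (Suc p) = Suc (f p)" "p < m \<Longrightarrow> f p < n"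
proof -
  show le: "f p \<le> n" if "p \<le> m" for p
    using f that PiE_mem[of f "{0..m}" "\<lambda>_. {0..n}" p] by (simp add: Delta0_Hom)
  show suc: "f (Suc p) = Suc (f p)" if "p < m" for p using f that by (simp add: Delta0_Hom)
  show "f p < n" if "p < m" for p using le[of "Suc p"] suc[OF that] that by simp
qed

lemma category_Delta0: "category Delta0"
  unfolding category_def
proof (intro conjI ballI)
  fix m n k f g assume f: "f \<in> Hom Delta0 m n" "g \<in> Hom Delta0 n k"
  show "Comp Delta0 m n k g f \<in> Hom Delta0 m k"
    by (simp add: Delta0_Hom PiE_iff compose_def Delta0_Hom_apply[OF f(1)] Delta0_Hom_apply[OF f(2)])
next
  fix m n f assume f: "f \<in> Hom Delta0 m n"
  then show "Comp Delta0 m m n f (Ident Delta0 m) = f" "Comp Delta0 m n n (Ident Delta0 n) f = f"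
    by (auto simp: Delta0_Hom PiE_iff compose_def fun_eq_iff extensional_def)
next
  fix l m n k f g h assume f: "f \<in> Hom Delta0 l m"
  then show "Comp Delta0 l n k h (Comp Delta0 l m n g f) = Comp Delta0 l m k (Comp Delta0 m n k h g) f"
    by (auto simp: Delta0_Hom PiE_iff compose_def fun_eq_iff)
qed (auto simp: Delta0_Hom)

lemma small_category_Delta0:
  assumes S: "universe S"
  shows "small_category S Delta0"
  unfolding small_category_def
proof (intro conjI ballI category_Delta0)
  show "small_set S (Obj Delta0)" by (rule small_set_inj_nat[OF S, of "\<lambda>n. n"]) simp
  fix m n
  have "finite (Hom Delta0 m n)"
    by (rule finite_subset[of _ "{0..m} \<rightarrow>\<^sub>E {0..n}"], rule subsetI, simp add: Delta0_Hom, rule finite_PiE)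
      simp_all
  then obtain f :: "(nat \<Rightarrow> nat) \<Rightarrow> nat" where "inj_on f (Hom Delta0 m n)"
    using finite_imp_inj_to_nat_seg by metis
  then show "small_set S (Hom Delta0 m n)" by (rule small_set_inj_nat[OF S])
qed

section \<open>Linear graphs and full faithfulness of the arity functor\<close>

context graph_universe
begin

abbreviation lin :: "nat \<Rightarrow> 'u mgraph" where "lin \<equiv> linear_graph"
abbreviation c :: "nat \<Rightarrow> 'u" where "c \<equiv> nat_code"
abbreviation i :: "(nat, nat \<Rightarrow> nat, 'u mgraph, ('u \<Rightarrow> 'u) \<times> ('u \<Rightarrow> 'u)) ftor"
  where "i \<equiv> linear_functor"

lemma inj_c: "inj c"
  by (rule inj_nat_code[OF universe_infinite_type[OF S]])

lemma inv_c [simp]: "inv c (c n) = n"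
  by (rule inv_f_f[OF inj_c])

lemma c_eq [simp]: "c m = c n \<longleftrightarrow> m = n"
  using inj_c by (auto dest: injD)

lemma lin_Verts: "Verts (lin n) = c ` {0..n}"
  and lin_Edges: "Edges (lin n) = c ` {1..n}"
  by (simp_all add: linear_graph_def)

lemma lin_vertI: "p \<le> n \<Longrightarrow> c p \<in> Verts (lin n)" and lin_edgeI: "p < n \<Longrightarrow> c (Suc p) \<in> Edges (lin n)"
  by (auto simp: lin_Verts lin_Edges)

lemma lin_vertE: "v \<in> Verts (lin n) \<Longrightarrow> (\<And>p. v = c p \<Longrightarrow> p \<le> n \<Longrightarrow> thesis) \<Longrightarrow> thesis"
  by (auto simp: lin_Verts)

text \<open>Indexing an edge by its source \<open>p\<close> removes the truncated subtraction from
  the definition: \<open>c (Suc p)\<close> runs from \<open>c p\<close> to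
  \<open>c (Suc p)\<close>.\<close>

lemma lin_edgeE:
  assumes "e \<in> Edges (lin n)" obtains p where "e = c (Suc p)" "p < n"
proof -
  obtain q where "e = c q" "q \<in> {1..n}" using assms by (auto simp: lin_Edges)
  then show thesis using that[of "q - 1"] by auto
qed

lemma lin_Src_Tgt [simp]:
  "p < n \<Longrightarrow> Src (lin n) (c (Suc p)) = c p" "p < n \<Longrightarrow> Tgt (lin n) (c (Suc p)) = c (Suc p)"
  by (simp_all add: linear_graph_def)

lemma lin_Obj: "lin n \<in> Obj \<G>"
proof -
  have "c ` A \<in> S" for A
    by (rule universe_subset[OF S universe_range_nat[OF S, of c]]) auto
  moreover have "Src (lin n) \<in> extensional (Edges (lin n))" "Tgt (lin n) \<in> extensional (Edges (lin n))"
    by (simp_all add: linear_graph_def)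
  ultimately show ?thesis
    by (auto simp: graph_Obj_iff PiE_iff lin_Verts[of n] elim!: lin_edgeE)
      (simp_all add: lin_Edges)
qed

lemma lin_Hom_apply:
  assumes h: "h \<in> Hom \<G> (lin n) G"
  shows "p \<le> n \<Longrightarrow> fst h (c p) \<in> Verts G" "p < n \<Longrightarrow> snd h (c (Suc p)) \<in> Edges G"
    "p < n \<Longrightarrow> Src G (snd h (c (Suc p))) = fst h (c p)"
    "p < n \<Longrightarrow> Tgt G (snd h (c (Suc p))) = fst h (c (Suc p))"
  using graph_Hom_apply[OF h] by (auto simp: lin_vertI lin_edgeI)

lemma lin_Hom_eqI:
  assumes "h \<in> Hom \<G> (lin n) G" "h' \<in> Hom \<G> (lin n) G"
    and "\<And>p. p \<le> n \<Longrightarrow> fst h (c p) = fst h' (c p)" "\<And>p. p < n \<Longrightarrow> snd h (c (Suc p)) = snd h' (c (Suc p))"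
  shows "h = h'"
  by (rule graph_Hom_eqI[OF assms(1,2)]) (auto elim!: lin_vertE lin_edgeE simp: assms(3,4))

lemma lin_Comp_apply [simp]:
  "p \<le> n \<Longrightarrow> fst (Comp \<G> (lin n) H K g h) (c p) = fst g (fst h (c p))"
  "p < n \<Longrightarrow> snd (Comp \<G> (lin n) H K g h) (c (Suc p)) = snd g (snd h (c (Suc p)))"
  by (simp_all add: lin_vertI lin_edgeI)

lemma linear_functor_simps [simp]:
  "FObj i = lin" "p \<le> m \<Longrightarrow> fst (FArr i m n f) (c p) = c (f p)"
  "p < m \<Longrightarrow> snd (FArr i m n f) (c (Suc p)) = c (f (Suc p))"
  by (auto simp: linear_functor_def)

lemma linear_functor_Arr:
  assumes f: "f \<in> Hom Delta0 m n"
  shows "FArr i m n f \<in> Hom \<G> (lin m) (lin n)"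
proof -
  have "fst (FArr i m n f) \<in> extensional (Verts (lin m))" "snd (FArr i m n f) \<in> extensional (Edges (lin m))"
    by (simp_all add: linear_functor_def lin_Verts lin_Edges)
  then show ?thesis
    by (auto simp: graph_Hom_iff PiE_iff Delta0_Hom_apply[OF f] lin_vertI lin_edgeI elim!: lin_vertE lin_edgeE)
qed

lemma linear_functor_functor: "is_functor Delta0 \<G> i"
  unfolding is_functor_def
proof (intro conjI ballI category_Delta0 category_graph_cat)
  fix m show "FObj i m \<in> Obj \<G>" by (simp add: lin_Obj)
next
  fix m n f assume "f \<in> Hom Delta0 m n"
  then show "FArr i m n f \<in> Hom \<G> (FObj i m) (FObj i n)" by (simp add: linear_functor_Arr)
next
  fix m
  have "FArr i m m (Ident Delta0 m) = Ident \<G> (lin m)"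
    by (rule lin_Hom_eqI[OF linear_functor_Arr category_Ident[OF category_graph_cat lin_Obj]])
      (use category_Ident[OF category_Delta0] in \<open>auto simp: lin_vertI lin_edgeI\<close>)
  then show "FArr i m m (Ident Delta0 m) = Ident \<G> (FObj i m)" by simp
next
  fix l m n f g assume f: "f \<in> Hom Delta0 l m" and g: "g \<in> Hom Delta0 m n"
  have "FArr i l n (Comp Delta0 l m n g f) = Comp \<G> (lin l) (lin m) (lin n) (FArr i m n g) (FArr i l m f)"
  proof (rule lin_Hom_eqI[OF linear_functor_Arr graph_Comp_in[OF lin_Obj linear_functor_Arr[OF f] linear_functor_Arr[OF g]]])
    show "Comp Delta0 l m n g f \<in> Hom Delta0 l n" using category_Comp[OF category_Delta0 _ _ _ f g] by simp
  qed (simp_all add: compose_def Delta0_Hom_apply[OF f])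
  then show "FArr i l n (Comp Delta0 l m n g f) =
      Comp \<G> (FObj i l) (FObj i m) (FObj i n) (FArr i m n g) (FArr i l m f)" by simp
qed

text \<open>The edge \<open>c (Suc q)\<close> starts at \<open>c q\<close>, so a morphism, which
  respects sources and targets, advances by one vertex along each edge. This is the successor
  condition on arrows of \<open>Delta0\<close>.\<close>

lemma linear_functor_full:
  assumes h: "h \<in> Hom \<G> (lin m) (lin n)"
  shows "\<exists>f\<in>Hom Delta0 m n. FArr i m n f = h"
proof
  define f where "f = (\<lambda>p\<in>{0..m}. inv c (fst h (c p)))"
  have v: "fst h (c p) = c (f p)" "f p \<le> n" if "p \<le> m" for p
    using lin_Hom_apply(1)[OF h that] that by (auto simp: f_def elim!: lin_vertE)
  have e: "snd h (c (Suc p)) = c (f (Suc p)) \<and> f (Suc p) = Suc (f p)" if p: "p < m" for p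
  proof -
    obtain q where q: "snd h (c (Suc p)) = c (Suc q)" "q < n"
      using lin_Hom_apply(2)[OF h p] by (auto elim!: lin_edgeE)
    have "c q = c (f p)" "c (Suc q) = c (f (Suc p))"
      using lin_Hom_apply(3,4)[OF h p] q v p by auto
    then show ?thesis using q by simp
  qed
  show f: "f \<in> Hom Delta0 m n"
    using v(2) e by (auto simp: Delta0_Hom PiE_iff) (simp add: f_def)
  show "FArr i m n f = h"
    by (rule lin_Hom_eqI[OF linear_functor_Arr[OF f] h]) (use v e in auto)
qed

lemma linear_functor_fully_faithful: "fully_faithful Delta0 \<G> i"
  unfolding fully_faithful_def
proof (intro conjI ballI linear_functor_functor)
  fix m n
  have "inj_on (FArr i m n) (Hom Delta0 m n)"
  proof (rule inj_onI)
    fix f g assume f: "f \<in> Hom Delta0 m n" and g: "g \<in> Hom Delta0 m n" and eq: "FArr i m n f = FArr i m n g"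
    have "f p = g p" if "p \<le> m" for p
      using arg_cong[OF eq, of "\<lambda>h. fst h (c p)"] that by simp
    then show "f = g"
      using f g by (auto simp: Delta0_Hom PiE_iff intro!: extensionalityI[of f "{0..m}" g])
  qed
  then show "bij_betw (FArr i m n) (Hom Delta0 m n) (Hom \<G> (FObj i m) (FObj i n))"
    using linear_functor_Arr linear_functor_full by (auto simp: bij_betw_def image_iff) metis
qed

section \<open>Paths as arrows out of linear graphs\<close>

text \<open>One half of the bijection between paths of length \<open>n\<close> and arrows out of
  \<open>lin n\<close>; the start vertex together with \<open>edge_list\<close> gives the inverse.
  Edge codes start at 1 and list positions at 0, hence the \<open>- 1\<close>.\<close>

definition path_hom :: "'u mgraph \<Rightarrow> 'u \<Rightarrow> 'u list \<Rightarrow> ('u \<Rightarrow> 'u) \<times> ('u \<Rightarrow> 'u)" where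
  "path_hom G v es = (\<lambda>x\<in>Verts (lin (length es)). path_end G v (take (inv c x) es),
     \<lambda>x\<in>Edges (lin (length es)). es ! (inv c x - 1))"

lemma path_hom_apply [simp]:
  "p \<le> length es \<Longrightarrow> fst (path_hom G v es) (c p) = path_end G v (take p es)"
  "p < length es \<Longrightarrow> snd (path_hom G v es) (c (Suc p)) = es ! p"
  by (simp_all add: path_hom_def lin_vertI lin_edgeI)

lemma path_hom_in:
  assumes G: "G \<in> Obj \<G>" and path: "is_path G v es"
  shows "path_hom G v es \<in> Hom \<G> (lin (length es)) G"
proof -
  have v: "path_end G v (take p es) \<in> Verts G" for p
    using path is_path_append[OF G, of v "take p es" "drop p es"] path_end_in by auto
  have e: "es ! p \<in> Edges G \<and> Src G (es ! p) = path_end G v (take p es) \<and>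
      Tgt G (es ! p) = path_end G v (take (Suc p) es)" if p: "p < length es" for p
  proof -
    have "is_path G v (take p es @ es ! p # drop (Suc p) es)"
      using path by (simp add: id_take_nth_drop[OF p, symmetric])
    then show ?thesis using p by (simp add: is_path_append[OF G] take_Suc_conv_app_nth)
  qed
  have "fst (path_hom G v es) \<in> extensional (Verts (lin (length es)))"
    "snd (path_hom G v es) \<in> extensional (Edges (lin (length es)))"
    by (simp_all add: path_hom_def)
  then show ?thesis
    using v e by (auto simp: graph_Hom_iff PiE_iff elim!: lin_vertE lin_edgeE)
qed

text \<open>Naturality, in the graph, of the correspondence between paths and arrows. In
  \<open>generic_factorization\<close> it shows that the comparison arrow followed by
  \<open>u'\<close> is \<open>u\<close>.\<close>

lemma Comp_path_hom:
  assumes G: "G \<in> Obj \<G>" and H: "H \<in> Obj \<G>" and path: "is_path G v es" and h: "h \<in> Hom \<G> G H"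
  shows "Comp \<G> (lin (length es)) G H h (path_hom G v es) = path_hom H (fst h v) (map (snd h) es)"
proof (rule lin_Hom_eqI[OF graph_Comp_in[OF lin_Obj path_hom_in[OF G path] h]])
  show "path_hom H (fst h v) (map (snd h) es) \<in> Hom \<G> (lin (length es)) H"
    using path_hom_in[OF H is_path_map[OF h path]] by simp
next
  fix p assume "p \<le> length es"
  moreover have "is_path G v (take p es)"
    using path is_path_append[OF G, of v "take p es" "drop p es"] by auto
  ultimately show "fst (Comp \<G> (lin (length es)) G H h (path_hom G v es)) (c p) =
      fst (path_hom H (fst h v) (map (snd h) es)) (c p)"
    using path_end_map[OF h] by (simp add: take_map)
qed auto

definition edge_list :: "nat \<Rightarrow> ('u \<Rightarrow> 'u) \<times> ('u \<Rightarrow> 'u) \<Rightarrow> 'u list" where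
  "edge_list n h = map (\<lambda>p. snd h (c (Suc p))) [0..<n]"

lemma edge_list_simps [simp]:
  "edge_list 0 h = []" "edge_list (Suc n) h = edge_list n h @ [snd h (c (Suc n))]"
  "length (edge_list n h) = n" "p < n \<Longrightarrow> edge_list n h ! p = snd h (c (Suc p))"
  "p \<le> n \<Longrightarrow> take p (edge_list n h) = edge_list p h"
  by (simp_all add: edge_list_def take_map)

text \<open>The induction runs over prefixes because each vertex \<open>c m\<close> has to be
  tracked as the end of the first \<open>m\<close> edges.\<close>

lemma edge_list_path:
  assumes G: "G \<in> Obj \<G>" and h: "h \<in> Hom \<G> (lin n) G"
  shows "m \<le> n \<Longrightarrow> is_path G (fst h (c 0)) (edge_list m h) \<and> path_end G (fst h (c 0)) (edge_list m h) = fst h (c m)"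
proof (induction m)
  case 0
  then show ?case using lin_Hom_apply(1)[OF h] by simp
next
  case (Suc m)
  then show ?case using lin_Hom_apply[OF h] by (simp add: is_path_append[OF G])
qed

lemma path_hom_edge_list:
  assumes G: "G \<in> Obj \<G>" and h: "h \<in> Hom \<G> (lin n) G"
  shows "path_hom G (fst h (c 0)) (edge_list n h) = h"
  using path_hom_in[OF G conjunct1[OF edge_list_path[OF G h order_refl]]] edge_list_path[OF G h]
  by (intro lin_Hom_eqI[OF _ h]) auto

text \<open>An arrow is recovered from its path, so the hom-set embeds into the edges of the free
  graph on \<open>G\<close>, which already form a member of \<open>S\<close>.\<close>

lemma small_lin_Hom:
  assumes G: "G \<in> Obj \<G>"
  shows "small_set S (Hom \<G> (lin n) G)"
  unfolding small_set_def
proof (intro exI conjI)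
  let ?f = "\<lambda>h. path_code (fst h (c 0), edge_list n h) :: 'u"
  show "inj_on ?f (Hom \<G> (lin n) G)"
  proof (rule inj_onI)
    fix h h' assume h: "h \<in> Hom \<G> (lin n) G" "h' \<in> Hom \<G> (lin n) G" and eq: "?f h = ?f h'"
    have "fst h (c 0) = fst h' (c 0)" "edge_list n h = edge_list n h'"
      using arg_cong[OF eq, of path_decode] by simp_all
    then have "path_hom G (fst h (c 0)) (edge_list n h) = path_hom G (fst h' (c 0)) (edge_list n h')"
      by (simp only:)
    then show "h = h'" by (simp only: path_hom_edge_list[OF G h(1)] path_hom_edge_list[OF G h(2)])
  qed
  show "?f ` Hom \<G> (lin n) G \<in> S"
  proof (rule universe_subset[OF S free_graph_Edges_in[OF G]], rule image_subsetI)
    fix h assume "h \<in> Hom \<G> (lin n) G"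
    from edge_list_path[OF G this order_refl] show "?f h \<in> Edges (free_graph G)" by simp
  qed
qed

end

section \<open>Density of the linear graphs\<close>

sublocale graph_universe \<subseteq> nerve_context S Delta0 \<G> i
  using linear_functor_functor small_lin_Hom by unfold_locales simp_all

context graph_universe
begin

text \<open>Fullness of the nerve, freed of codes. The vertex part of \<open>h\<close> is read off
  from \<open>\<Phi> 0\<close> and the edge part from \<open>\<Phi> 1\<close>; naturality along the
  arrows that pick out a vertex or an edge of \<open>[n]\<close> then determines every
  \<open>\<Phi> n\<close>.\<close>

lemma natural_family_from_hom:
  assumes G: "G \<in> Obj \<G>" and H: "H \<in> Obj \<G>"
    and \<Phi>: "\<And>n x. x \<in> Hom \<G> (lin n) G \<Longrightarrow> \<Phi> n x \<in> Hom \<G> (lin n) H"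
    and nat: "\<And>m n f x. f \<in> Hom Delta0 m n \<Longrightarrow> x \<in> Hom \<G> (lin n) G \<Longrightarrow>
      \<Phi> m (Comp \<G> (lin m) (lin n) G x (FArr i m n f)) = Comp \<G> (lin m) (lin n) H (\<Phi> n x) (FArr i m n f)"
  shows "\<exists>h\<in>Hom \<G> G H. \<forall>n. \<forall>x\<in>Hom \<G> (lin n) G. \<Phi> n x = Comp \<G> (lin n) G H h x"
proof -
  define h where "h = (\<lambda>v\<in>Verts G. fst (\<Phi> 0 (path_hom G v [])) (c 0),
    \<lambda>e\<in>Edges G. snd (\<Phi> 1 (path_hom G (Src G e) [e])) (c (Suc 0)))"
  have point: "path_hom G v [] \<in> Hom \<G> (lin 0) G" if "v \<in> Verts G" for v
    using path_hom_in[OF G, of v "[]"] that by simp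
  have arrow: "path_hom G (Src G e) [e] \<in> Hom \<G> (lin 1) G" if "e \<in> Edges G" for e
    using path_hom_in[OF G, of "Src G e" "[e]"] that graph_src_tgt[OF G] by simp
  have vert: "fst (\<Phi> n x) (c p) = fst h (fst x (c p))" if x: "x \<in> Hom \<G> (lin n) G" and p: "p \<le> n" for n x p
  proof -
    define f where "f = (\<lambda>q\<in>{0..0::nat}. p)"
    have f: "f \<in> Hom Delta0 0 n" using p by (auto simp: f_def Delta0_Hom)
    have v: "fst x (c p) \<in> Verts G" by (rule lin_Hom_apply(1)[OF x p])
    have "Comp \<G> (lin 0) (lin n) G x (FArr i 0 n f) = path_hom G (fst x (c p)) []"
      by (rule lin_Hom_eqI[OF graph_Comp_in[OF lin_Obj linear_functor_Arr[OF f] x] point[OF v]])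
        (auto simp: f_def)
    then have "\<Phi> 0 (path_hom G (fst x (c p)) []) = Comp \<G> (lin 0) (lin n) H (\<Phi> n x) (FArr i 0 n f)"
      using nat[OF f x] by simp
    then show ?thesis using v by (simp add: h_def f_def)
  qed
  have edge: "snd (\<Phi> n x) (c (Suc p)) = snd h (snd x (c (Suc p)))"
    if x: "x \<in> Hom \<G> (lin n) G" and p: "p < n" for n x p
  proof -
    \<comment> \<open>The arrow from \<open>[1]\<close> that selects the edge from \<open>p\<close>
      to \<open>p + 1\<close>.\<close>
    define f where "f = (\<lambda>q\<in>{0..1::nat}. p + q)"
    have f: "f \<in> Hom Delta0 1 n" using p by (auto simp: f_def Delta0_Hom)
    have e: "snd x (c (Suc p)) \<in> Edges G" by (rule lin_Hom_apply(2)[OF x p])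
    have "Comp \<G> (lin 1) (lin n) G x (FArr i 1 n f) = path_hom G (Src G (snd x (c (Suc p)))) [snd x (c (Suc p))]"
    proof (rule lin_Hom_eqI[OF graph_Comp_in[OF lin_Obj linear_functor_Arr[OF f] x] arrow[OF e]])
      fix q :: nat assume "q \<le> 1"
      then have "q = 0 \<or> q = 1" by auto
      then show "fst (Comp \<G> (lin 1) (lin n) G x (FArr i 1 n f)) (c q) =
          fst (path_hom G (Src G (snd x (c (Suc p)))) [snd x (c (Suc p))]) (c q)"
        using lin_Hom_apply(3,4)[OF x p] by (auto simp: f_def)
    qed (auto simp: f_def)
    then have "\<Phi> 1 (path_hom G (Src G (snd x (c (Suc p)))) [snd x (c (Suc p))]) =
        Comp \<G> (lin 1) (lin n) H (\<Phi> n x) (FArr i 1 n f)"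
      using nat[OF f x] by simp
    then show ?thesis using e by (simp add: h_def f_def)
  qed
  have h: "h \<in> Hom \<G> G H"
  proof -
    have "fst h v \<in> Verts H" if "v \<in> Verts G" for v
      using lin_Hom_apply(1)[OF \<Phi>[OF point[OF that]], of 0] that by (simp add: h_def)
    moreover have "snd h e \<in> Edges H \<and> Src H (snd h e) = fst h (Src G e) \<and> Tgt H (snd h e) = fst h (Tgt G e)"
      if e: "e \<in> Edges G" for e
    proof -
      let ?a = "path_hom G (Src G e) [e]"
      have "snd h e = snd (\<Phi> 1 ?a) (c (Suc 0))" using e by (simp add: h_def)
      \<comment> \<open>Evaluating \<open>vert\<close> at both vertices of \<open>[1]\<close> is
        what makes \<open>h\<close> commute with source and target.\<close>
      moreover have "fst (\<Phi> 1 ?a) (c 0) = fst h (Src G e)" "fst (\<Phi> 1 ?a) (c (Suc 0)) = fst h (Tgt G e)"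
        using vert[OF arrow[OF e], of 0] vert[OF arrow[OF e], of "Suc 0"] by simp_all
      ultimately show ?thesis using lin_Hom_apply[OF \<Phi>[OF arrow[OF e]], of 0] by simp
    qed
    ultimately show ?thesis by (auto simp: graph_Hom_iff PiE_iff) (simp_all add: h_def)
  qed
  show ?thesis
  proof (intro bexI[of _ h] allI ballI h)
    fix n x assume x: "x \<in> Hom \<G> (lin n) G"
    show "\<Phi> n x = Comp \<G> (lin n) G H h x"
      by (rule lin_Hom_eqI[OF \<Phi>[OF x] graph_Comp_in[OF lin_Obj x h]]) (simp_all add: vert[OF x] edge[OF x])
  qed
qed

lemma linear_functor_dense: "dense_functor S Delta0 \<G> i"
  unfolding dense_functor_def fully_faithful_def
proof (intro conjI ballI small_category_Delta0[OF S] linear_functor_functor nerve_functor)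
  fix n G assume "G \<in> Obj \<G>"
  then show "small_set S (Hom \<G> (FObj i n) G)" using small_lin_Hom by simp
next
  fix G H assume G: "G \<in> Obj \<G>" and H: "H \<in> Obj \<G>"
  have "inj_on (FArr N G H) (Hom \<G> G H)"
  proof (rule inj_onI)
    fix h h' assume h: "h \<in> Hom \<G> G H" and h': "h' \<in> Hom \<G> G H" and eq: "FArr N G H h = FArr N G H h'"
    \<comment> \<open>Equality of nerves, decoded. Paths of length 0 and 1 then test
      \<open>h\<close> and \<open>h'\<close> on vertices and on edges.\<close>
    have *: "Comp \<G> (lin n) G H h x = Comp \<G> (lin n) G H h' x" if x: "x \<in> Hom \<G> (lin n) G" for n x
      using arg_cong[OF eq, of "\<lambda>\<theta>. \<theta> n (code n G x)"] x G H h h'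
        code_inj[of n H "Comp \<G> (lin n) G H h x" "Comp \<G> (lin n) G H h' x"]
        nerve_FArr[of n G x H h] nerve_FArr[of n G x H h']
      by (simp add: graph_Comp_in[OF lin_Obj x])
    show "h = h'"
    proof (rule graph_Hom_eqI[OF h h'])
      fix v assume "v \<in> Verts G"
      then have "path_hom G v [] \<in> Hom \<G> (lin 0) G" using path_hom_in[OF G, of v "[]"] by simp
      from arg_cong[OF *[OF this], of "\<lambda>h. fst h (c 0)"] show "fst h v = fst h' v" by simp
    next
      fix e assume "e \<in> Edges G"
      then have "path_hom G (Src G e) [e] \<in> Hom \<G> (lin 1) G"
        using path_hom_in[OF G, of "Src G e" "[e]"] graph_src_tgt[OF G] by simp
      from arg_cong[OF *[OF this], of "\<lambda>h. snd h (c (Suc 0))"] show "snd h e = snd h' e" by simp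
    qed
  qed
  moreover have "\<exists>h\<in>Hom \<G> G H. FArr N G H h = \<theta>"
    if "\<theta> \<in> Hom (presheaf_cat S Delta0) (FObj N G) (FObj N H)" for \<theta>
  proof -
    have \<theta>: "nat_trans (op_cat Delta0) (set_cat S) (FObj N G) (FObj N H) \<theta>"
      using that by (simp add: presheaf_cat_def)
    \<comment> \<open>Stripping the codes from \<theta> makes \<open>natural_family_from_hom\<close>
      applicable; naturality is transported through injectivity of \<open>code\<close>.\<close>
    define \<Phi> where "\<Phi> n x = hom_decode S \<G> (lin n) H (\<theta> n (code n G x))" for n x
    have \<Phi>: "\<Phi> n x \<in> Hom \<G> (lin n) H \<and> \<theta> n (code n G x) = code n H (\<Phi> n x)"
      if x: "x \<in> Hom \<G> (lin n) G" for n x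
    proof -
      have "\<theta> n (code n G x) \<in> FObj (FObj N H) n"
        using nat_trans_in[OF \<theta>, of n] x by (auto simp: PiE_iff nerve_FObj)
      then obtain y where "\<theta> n (code n G x) = code n H y" "y \<in> Hom \<G> (lin n) H"
        by (auto simp: nerve_FObj)
      then show ?thesis using decode_code[of n H y] H by (simp add: \<Phi>_def)
    qed
    have nat: "\<Phi> m (Comp \<G> (lin m) (lin n) G x (FArr i m n f)) = Comp \<G> (lin m) (lin n) H (\<Phi> n x) (FArr i m n f)"
      if f: "f \<in> Hom Delta0 m n" and x: "x \<in> Hom \<G> (lin n) G" for m n f x
    proof -
      let ?x = "Comp \<G> (lin m) (lin n) G x (FArr i m n f)"
      have x': "?x \<in> Hom \<G> (lin m) G" by (rule graph_Comp_in[OF lin_Obj linear_functor_Arr[OF f] x])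
      have "code m H (\<Phi> m ?x) = \<theta> m (code m G ?x)" using \<Phi>[OF x'] by simp
      also have "\<dots> = \<theta> m (FArr (FObj N G) n m f (code n G x))"
        using nerve_obj_FArr[of n m f G x] f x G by simp
      also have "\<dots> = FArr (FObj N H) n m f (\<theta> n (code n G x))"
        using presheaf_morphism_natural[OF \<theta>, of n m f "code n G x"] f x by (simp add: nerve_FObj)
      also have "\<dots> = code m H (Comp \<G> (lin m) (lin n) H (\<Phi> n x) (FArr i m n f))"
        using nerve_obj_FArr[of n m f H "\<Phi> n x"] f \<Phi>[OF x] H by simp
      finally show ?thesis
        using code_inj[of m H] \<Phi>[OF x'] H graph_Comp_in[OF lin_Obj linear_functor_Arr[OF f] conjunct1[OF \<Phi>[OF x]]]
        by simp
    qed
    obtain h where h: "h \<in> Hom \<G> G H" "\<And>n x. x \<in> Hom \<G> (lin n) G \<Longrightarrow> \<Phi> n x = Comp \<G> (lin n) G H h x"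
      using natural_family_from_hom[OF G H, of \<Phi>] \<Phi> nat by blast
    have Nh: "nat_trans (op_cat Delta0) (set_cat S) (FObj N G) (FObj N H) (FArr N G H h)"
      by (rule nerve_FArr_nat_trans[OF G H h(1)])
    have "FArr N G H h = \<theta>"
    proof
      fix n
      have "FArr N G H h n (code n G x) = \<theta> n (code n G x)" if "x \<in> Hom \<G> (lin n) G" for x
        using that \<Phi>[OF that] h(2)[OF that] nerve_FArr[of n G x H h] G by simp
      then show "FArr N G H h n = \<theta> n"
        using nat_trans_in[OF Nh, of n] nat_trans_in[OF \<theta>, of n]
        by (intro extensionalityI[of _ "FObj (FObj N G) n"]) (auto simp: PiE_iff nerve_FObj)
    qed
    then show ?thesis using h(1) by blast
  qed
  ultimately show "bij_betw (FArr N G H) (Hom \<G> G H) (Hom (presheaf_cat S Delta0) (FObj N G) (FObj N H))"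
    using functor_Arr[OF nerve_functor G H] by (auto simp: bij_betw_def image_iff)
qed

section \<open>Generic factorizations\<close>

text \<open>Edges carry the code of their target, so the path from vertex \<open>a\<close> to vertex
  \<open>b\<close> lists \<open>a + 1\<close> up to \<open>b\<close>; this accounts for both
  \<open>Suc\<close>.\<close>

lemma lin_path:
  assumes "b \<le> k" "a \<le> b"
  shows "is_path (lin k) (c a) (map c [Suc a..<Suc b])"
    "path_end (lin k) (c a) (map c [Suc a..<Suc b]) = c b"
proof -
  have "is_path (lin k) (c a) (map c [Suc a..<Suc b]) \<and> path_end (lin k) (c a) (map c [Suc a..<Suc b]) = c b"
    using assms(2,1)
  proof (induction b rule: dec_induct)
    case base
    then show ?case by (simp add: lin_vertI)
  next
    case (step b)
    then show ?case by (simp add: is_path_append[OF lin_Obj] lin_edgeI lin_vertI)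
  qed
  then show "is_path (lin k) (c a) (map c [Suc a..<Suc b])"
    "path_end (lin k) (c a) (map c [Suc a..<Suc b]) = c b" by auto
qed

text \<open>The generic arrows into free categories on linear graphs, indexed by the lengths of the paths.\<close>

definition subdivision :: "nat list \<Rightarrow> ('u \<Rightarrow> 'u) \<times> ('u \<Rightarrow> 'u)" where
  "subdivision ls = (\<lambda>x\<in>Verts (lin (length ls)). c (sum_list (take (inv c x) ls)),
     \<lambda>x\<in>Edges (lin (length ls)).
       path_code (c (sum_list (take (inv c x - 1) ls)),
         map c [Suc (sum_list (take (inv c x - 1) ls))..<Suc (sum_list (take (inv c x) ls))]))"

lemma subdivision_apply [simp]:
  "p \<le> length ls \<Longrightarrow> fst (subdivision ls) (c p) = c (sum_list (take p ls))"
  "p < length ls \<Longrightarrow> snd (subdivision ls) (c (Suc p)) = path_code (c (sum_list (take p ls)),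
     map c [Suc (sum_list (take p ls))..<Suc (sum_list (take (Suc p) ls))])"
  by (simp_all add: subdivision_def lin_vertI lin_edgeI)

text \<open>An instance of \<open>lin_path\<close> between consecutive partial sums. Blocks of
  length zero are covered: the two sums coincide and the path is empty.\<close>

lemma subdivision_path:
  "is_path (lin (sum_list ls)) (c (sum_list (take p ls)))
     (map c [Suc (sum_list (take p ls))..<Suc (sum_list (take (Suc p) ls))])"
  "path_end (lin (sum_list ls)) (c (sum_list (take p ls)))
     (map c [Suc (sum_list (take p ls))..<Suc (sum_list (take (Suc p) ls))]) = c (sum_list (take (Suc p) ls))"
  by (rule lin_path; rule sum_list_take_le_sum sum_list_take_le; simp)+

lemma subdivision_in: "subdivision ls \<in> Hom \<G> (lin (length ls)) (free_graph (lin (sum_list ls)))"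
proof -
  have "fst (subdivision ls) \<in> extensional (Verts (lin (length ls)))"
    "snd (subdivision ls) \<in> extensional (Edges (lin (length ls)))"
    by (simp_all add: subdivision_def)
  then show ?thesis
    by (auto simp: graph_Hom_iff PiE_iff lin_vertI sum_list_take_le_sum subdivision_path
        simp del: upt_Suc elim!: lin_vertE lin_edgeE)
qed

definition edge_paths :: "nat \<Rightarrow> ('u \<Rightarrow> 'u) \<times> ('u \<Rightarrow> 'u) \<Rightarrow> 'u list list" where
  "edge_paths n x = map (\<lambda>q. snd (path_decode q)) (edge_list n x)"

lemma edge_paths_simps [simp]:
  "length (edge_paths n x) = n" "p < n \<Longrightarrow> edge_paths n x ! p = snd (path_decode (snd x (c (Suc p))))"
  "p \<le> n \<Longrightarrow> take p (edge_paths n x) = edge_paths p x"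
  by (simp_all add: edge_paths_def take_map)

text \<open>Concatenation is the multiplication applied to the path of paths
  \<open>edge_list p x\<close>, so \<open>is_path_flatten\<close> applies. Having it for every
  prefix locates the vertex \<open>c p\<close> of \<open>x\<close> on the concatenated path.\<close>

lemma concat_edge_paths:
  assumes G: "G \<in> Obj \<G>" and x: "x \<in> Hom \<G> (lin n) (free_graph G)" and p: "p \<le> n"
  shows "is_path G (fst x (c 0)) (concat (edge_paths p x))"
    "path_end G (fst x (c 0)) (concat (edge_paths p x)) = fst x (c p)"
proof -
  have "concat (edge_paths p x) = flatten (edge_list p x)" by (simp add: edge_paths_def flatten_def)
  then show "is_path G (fst x (c 0)) (concat (edge_paths p x))"
    "path_end G (fst x (c 0)) (concat (edge_paths p x)) = fst x (c p)"
    using edge_list_path[OF free_graph_Obj[OF G] x p] is_path_flatten[OF G] by auto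
qed

lemma edge_paths_edge:
  assumes G: "G \<in> Obj \<G>" and x: "x \<in> Hom \<G> (lin n) (free_graph G)" and p: "p < n"
  shows "snd x (c (Suc p)) = path_code (fst x (c p), edge_paths n x ! p)"
    "is_path G (fst x (c p)) (edge_paths n x ! p)"
proof -
  obtain v es where "snd x (c (Suc p)) = path_code (v, es)" "is_path G v es"
    using lin_Hom_apply(2)[OF x p] by (auto elim: free_graph_EdgesE)
  then show "snd x (c (Suc p)) = path_code (fst x (c p), edge_paths n x ! p)"
    "is_path G (fst x (c p)) (edge_paths n x ! p)"
    using lin_Hom_apply(3)[OF x p] p by auto
qed

text \<open>The subdivision sends vertex \<open>p\<close> to the partial sum at which the
  concatenated path has reached \<open>fst x (c p)\<close>, and the next edge to the stretch that
  \<open>concat_segment\<close> identifies with block \<open>p\<close>.\<close>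

lemma subdivision_factorization:
  assumes G: "G \<in> Obj \<G>" and x: "x \<in> Hom \<G> (lin n) (free_graph G)"
  defines "es \<equiv> concat (edge_paths n x)"
  shows "Comp \<G> (lin n) (free_graph (lin (length es))) (free_graph G)
      (FArr T (lin (length es)) G (path_hom G (fst x (c 0)) es)) (subdivision (map length (edge_paths n x))) = x"
proof -
  let ?ls = "map length (edge_paths n x)" and ?v = "fst x (c 0)"
  have len: "length es = sum_list ?ls" by (simp add: es_def length_concat)
  note path = concat_edge_paths(1)[OF G x order_refl, folded es_def]
  have sub: "subdivision ?ls \<in> Hom \<G> (lin n) (free_graph (lin (length es)))"
    using subdivision_in[of ?ls] by (simp add: len)
  show ?thesis
  proof (rule lin_Hom_eqI[OF graph_Comp_in[OF lin_Obj sub free_functor_Arr[OF lin_Obj path_hom_in[OF G path]]] x])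
    have vert: "fst (path_hom G ?v es) (c (sum_list (take p ?ls))) = fst x (c p)" if p: "p \<le> n" for p
      using concat_edge_paths(2)[OF G x p] take_concat[of p "edge_paths n x"] p
        sum_list_take_le_sum[of p ?ls] by (simp add: es_def length_concat)
    fix p
    show "fst (Comp \<G> (lin n) (free_graph (lin (length es))) (free_graph G)
        (FArr T (lin (length es)) G (path_hom G ?v es)) (subdivision ?ls)) (c p) = fst x (c p)" if "p \<le> n"
      using that vert[OF that] by simp
    show "snd (Comp \<G> (lin n) (free_graph (lin (length es))) (free_graph G)
        (FArr T (lin (length es)) G (path_hom G ?v es)) (subdivision ?ls)) (c (Suc p)) = snd x (c (Suc p))"
      if p: "p < n"
    proof -
      let ?a = "sum_list (take p ?ls)" and ?b = "sum_list (take (Suc p) ?ls)"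
      \<comment> \<open>The edge coded by \<open>c (Suc q)\<close> carries entry \<open>q\<close> of
        \<open>es\<close>, which shifts the interval down by one.\<close>
      have "map (snd (path_hom G ?v es)) (map c [Suc ?a..<Suc ?b]) = map (\<lambda>q. snd (path_hom G ?v es) (c (Suc q))) [?a..<?b]"
        by (simp add: map_Suc_upt[symmetric] comp_def del: upt_Suc)
      also have "\<dots> = map (\<lambda>q. es ! q) [?a..<?b]"
        using sum_list_take_le_sum[of "Suc p" ?ls] len by (intro map_cong) auto
      also have "\<dots> = edge_paths n x ! p"
        unfolding es_def by (rule concat_segment) (simp add: p)
      finally show ?thesis
        using p vert[of p] subdivision_path(1)[of ?ls p] edge_paths_edge(1)[OF G x p]
        by (simp add: len del: upt_Suc map_map edge_paths_simps(2))
    qed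
  qed
qed

text \<open>\<open>T u\<close> maps the edges inside each code, so block boundaries survive. Taking
  lengths or concatenations of this one equation gives both facts used for initiality.\<close>

lemma edge_paths_Comp:
  assumes k: "k \<in> Obj \<G>" and u: "u \<in> Hom \<G> k G" and y: "y \<in> Hom \<G> (lin n) (free_graph k)"
  defines "x \<equiv> Comp \<G> (lin n) (free_graph k) (free_graph G) (FArr T k G u) y"
  shows "edge_paths n x = map (map (snd u)) (edge_paths n y)"
proof (rule nth_equalityI)
  fix p assume "p < length (edge_paths n x)"
  then have p: "p < n" by simp
  obtain es where "snd y (c (Suc p)) = path_code (fst y (c p), es)" "is_path k (fst y (c p)) es"
    using edge_paths_edge[OF k y p] by blast
  then show "edge_paths n x ! p = map (map (snd u)) (edge_paths n y) ! p"
    using p by (simp add: x_def)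
qed simp

text \<open>The comparison arrow is found inside \<open>[k']\<close>: \<open>y'\<close> is itself a
  sequence of paths, so it factors through the concatenation of its own blocks. Since
  \<open>x\<close> and \<open>y'\<close> have the same block lengths, both factorizations begin with
  the same subdivision.\<close>

lemma generic_factorization:
  assumes G: "G \<in> Obj \<G>" and x: "x \<in> Hom \<G> (lin n) (free_graph G)"
  shows "\<exists>k. \<exists>u\<in>Hom \<G> (lin k) G. \<exists>y\<in>Hom \<G> (lin n) (free_graph (lin k)).
    x = Comp \<G> (lin n) (free_graph (lin k)) (free_graph G) (FArr T (lin k) G u) y \<and>
    (\<forall>k'. \<forall>u'\<in>Hom \<G> (lin k') G. \<forall>y'\<in>Hom \<G> (lin n) (free_graph (lin k')).
       x = Comp \<G> (lin n) (free_graph (lin k')) (free_graph G) (FArr T (lin k') G u') y' \<longrightarrow>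
       (\<exists>j\<in>Hom Delta0 k k'. Comp \<G> (lin k) (lin k') G u' (FArr i k k' j) = u \<and>
          Comp \<G> (lin n) (free_graph (lin k)) (free_graph (lin k')) (FArr T (lin k) (lin k') (FArr i k k' j)) y = y'))"
proof -
  let ?es = "concat (edge_paths n x)" and ?v = "fst x (c 0)" and ?y = "subdivision (map length (edge_paths n x))"
  let ?k = "length ?es"
  note path = concat_edge_paths(1)[OF G x order_refl]
  note u = path_hom_in[OF G path]
  have y: "?y \<in> Hom \<G> (lin n) (free_graph (lin ?k))"
    using subdivision_in[of "map length (edge_paths n x)"] by (simp add: length_concat)
  show ?thesis
  proof (intro exI[of _ ?k] bexI[OF _ u] bexI[OF _ y] conjI allI ballI impI)
    show "x = Comp \<G> (lin n) (free_graph (lin ?k)) (free_graph G) (FArr T (lin ?k) G (path_hom G ?v ?es)) ?y"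
      by (rule subdivision_factorization[OF G x, symmetric])
  next
    fix k' u' y' assume u': "u' \<in> Hom \<G> (lin k') G" and y': "y' \<in> Hom \<G> (lin n) (free_graph (lin k'))"
      and eq: "x = Comp \<G> (lin n) (free_graph (lin k')) (free_graph G) (FArr T (lin k') G u') y'"
    let ?es' = "concat (edge_paths n y')" and ?v' = "fst y' (c 0)"
    note path' = concat_edge_paths(1)[OF lin_Obj y' order_refl]
    have ep: "edge_paths n x = map (map (snd u')) (edge_paths n y')"
      unfolding eq by (rule edge_paths_Comp[OF lin_Obj u' y'])
    have es: "?es = map (snd u') ?es'" by (simp add: ep map_concat)
    have v: "?v = fst u' ?v'" by (simp add: eq)
    have k: "?k = length ?es'" by (simp add: es)
    have ls: "map length (edge_paths n x) = map length (edge_paths n y')" by (simp add: ep)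
    \<comment> \<open>Fullness of \<open>i\<close> makes this path in a linear graph an arrow of
      \<open>Delta0\<close>; its source is \<open>?k\<close> because mapping with \<open>u'\<close>
      preserves the total length.\<close>
    obtain j where j: "j \<in> Hom Delta0 ?k k'" "FArr i ?k k' j = path_hom (lin k') ?v' ?es'"
      using linear_functor_full[OF path_hom_in[OF lin_Obj path']] k by auto
    have "Comp \<G> (lin ?k) (lin k') G u' (FArr i ?k k' j) = path_hom G ?v ?es"
      unfolding j(2) unfolding es v length_map by (rule Comp_path_hom[OF lin_Obj G path' u'])
    moreover have "Comp \<G> (lin n) (free_graph (lin ?k)) (free_graph (lin k')) (FArr T (lin ?k) (lin k') (FArr i ?k k' j)) ?y = y'"
      unfolding j(2) unfolding k ls by (rule subdivision_factorization[OF lin_Obj y'])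
    ultimately show "\<exists>j\<in>Hom Delta0 ?k k'. Comp \<G> (lin ?k) (lin k') G u' (FArr i ?k k' j) = path_hom G ?v ?es \<and>
        Comp \<G> (lin n) (free_graph (lin ?k)) (free_graph (lin k')) (FArr T (lin ?k) (lin k') (FArr i ?k k' j)) ?y = y'"
      using j(1) by blast
  qed
qed

section \<open>The free category monad as a monad with arities\<close>

lemma nerve_free_kan_extension:
  "is_left_kan_extension Delta0 \<G> (presheaf_cat S Delta0) i (N \<circ>\<^sub>F T \<circ>\<^sub>F i) (N \<circ>\<^sub>F T)
     (id_trans Delta0 (presheaf_cat S Delta0) (N \<circ>\<^sub>F T \<circ>\<^sub>F i))"
  by (rule nerve_left_kan_extension[OF linear_functor_functor free_functor_functor])
    (use generic_factorization in simp)

lemma free_monad_with_arities: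
  "monad_with_arities S \<G> T (free_unit S) (free_mult S) Delta0 i"
proof -
  have "fully_faithful \<G> (presheaf_cat S Delta0) N"
    using linear_functor_dense by (simp add: dense_functor_def)
  then show ?thesis
    unfolding monad_with_arities_def Let_def
    using free_monad small_category_Delta0[OF S] linear_functor_fully_faithful linear_functor_dense
      nerve_free_kan_extension
      fully_faithful_reflects_kan_extension[OF nerve_free_kan_extension _ free_functor_functor]
    by blast
qed

end

theorem mainTheorem1:
  fixes S :: "'u set set"
  assumes "universe S"
  shows "monad_with_arities S (graph_cat S) free_functor (free_unit S) (free_mult S)
           Delta0 linear_functor"
  by (rule graph_universe.free_monad_with_arities[OF graph_universe.intro[OF assms]])

end
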